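(* For $b\in\mathbb C$ let $\hat{\mathcal L}=\hat{\mathcal L}(b)$ be the $\mathbb Z/2\mathbb Z$-graded complex vector space with basis $\{L_i,H_j,c_H\mid i,j\in\mathbb Z\}$ (even) and $\{G_k^{+},G_k^-\mid k\in\mathbb Z\}$ (odd), with $c_H$ central and with brackets, for $i,j\in\mathbb Z$, $$[L_i,L_j]=(i-j)L_{i+j}+(i^3-i)(b-b^2)c_H\delta_{i+j,0},$$ $$[L_i,H_j]=-jH_{i+j}+\tfrac{i(i-1)}2(1-2b)c_H\delta_{i+j,0},\qquad [H_i,H_j]=i\,c_H\delta_{i+j,0},$$ $$[L_i,G_j^+]=(-j+i(1-b))G_{i+j}^+,\qquad [L_i,G_j^-]=(-j+ib)G_{i+j}^-,$$ $$[H_i,G_j^{\pm}]=\pm G_{i+j}^{\pm},\qquad [G_i^+,G_j^+]=[G_i^-,G_j^-]=0,$$ $$[G_i^-,G_j^+]=L_{i+j}+(-i+(i+j)b)H_{i+j}+\tfrac{i(i+1-2b)+b^2-b}2\,c_H\delta_{i+j,0}.$$ Then the possible nontrivial super-extensions (including their central extensions) of the Heisenberg-Virasoro type algebra $\tilde{\mathcal L}_{\bar 0}$ are, up to isomorphism, the superalgebras $\hat{\mathcal L}(b)$, $b\in\mathbb C$. That is: each $\hat{\mathcal L}(b)$ is a Lie superalgebra; and for every nontrivial super-extension $\tilde{\mathcal L}=\tilde{\mathcal L}_{\bar 0}\oplus\tilde{\mathcal L}_{\bar 1}$ of $\tilde{\mathcal L}_{\bar 0}$ there is $b\in\mathbb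 C$ such that $\tilde{\mathcal L}\cong\hat{\mathcal L}(b)/\mathbb Cc_H$ and, under this identification, every $2$-cocycle $\tilde{\mathcal L}\times\tilde{\mathcal L}\to\mathbb C$ is, modulo coboundaries, equal to the super-skew-symmetric bilinear form $\psi$ given, for some scalar $\kappa\in\mathbb C$ and all $i,j\in\mathbb Z$, by $$\psi(L_i,L_j)=(i^3-i)(b-b^2)\kappa\,\delta_{i+j,0},\qquad \psi(L_i,H_j)=\tfrac{i(i-1)}2(1-2b)\kappa\,\delta_{i+j,0},\qquad \psi(H_i,H_j)=i\,\kappa\,\delta_{i+j,0},$$ $$\psi(G_i^-,G_j^+)=\tfrac{i(i+1-2b)+b^2-b}2\,\kappa\,\delta_{i+j,0},\qquad \psi(L_i,G_j^{\pm})=\psi(H_i,G_j^{\pm})=\psi(G_i^+,G_j^+)=\psi(G_i^-,G_j^-)=0.$$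
   Context: The Heisenberg-Virasoro type Lie algebra (with one-dimensional center $\mathbb CH_0$) is $\tilde{\mathcal L}_{\bar 0}=\mathrm{span}_{\mathbb C}\{L_m,H_n\mid m,n\in\mathbb Z\}$ (the listed elements forming a basis) with brackets $$[L_m,L_n]=(m-n)L_{m+n},\qquad [H_m,H_n]=0,\qquad [L_m,H_n]=-nH_{m+n}.$$ By a super-extension of $\tilde{\mathcal L}_{\bar 0}$ is meant a Lie superalgebra $\tilde{\mathcal L}=\tilde{\mathcal L}_{\bar 0}\oplus\tilde{\mathcal L}_{\bar 1}$ whose even part is $\tilde{\mathcal L}_{\bar 0}$ and whose odd part is, as an $\tilde{\mathcal L}_{\bar 0}$-module, a direct sum of two modules of the intermediate series: $\tilde{\mathcal L}_{\bar 1}$ has basis $\{G_i^+,G_i^-\mid i\in\mathbb Z\}$ with $$[L_m,G_i^{\pm}]=(a^{\pm}-i+mb^{\pm})G_{m+i}^{\pm},\qquad [H_n,G_i^+]=f_1G_{n+i}^+,\qquad [H_n,G_i^-]=f_2G_{n+i}^-$$ for some $a^{\pm},b^{\pm},f_1,f_2\in\mathbb C$ with $(f_1,f_2)\ne(0,0)$, and such that for all $i,j$ the bracket of two odd basis elements with indices $i$ and $j$ lies in $\mathbb CL_{i+j}+\mathbb CH_{i+j}$. It is nontrivial if $[\tilde{\mathcal L}_{\bar 1},\tilde{\mathcal L}_{\bar 1}]\neq 0$. A $2$-cocycle $\varphi:\tilde{\mathcal L}\times\tilde{\mathcal L}\to\mathbb C$ is a (super-skew-symmetric) bilinear form defining a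 central extension $\tilde{\mathcal L}\oplus\mathbb C$ of the Lie superalgebra $\tilde{\mathcal L}$; a coboundary is a form $\varphi_f(x,y)=f([x,y])$ for a linear map $f:\tilde{\mathcal L}\to\mathbb C$. *)

theory Defs
  imports Complex_Main "HOL-Library.Poly_Mapping" "HOL-Library.Product_Plus" "HOL-Library.Z2"
begin

section \<open>Lie superalgebras over the complex numbers\<close>

text \<open>
  A complex vector space is a type of class \<^class>\<open>ab_group_add\<close> with an explicit scalar
  multiplication (locale \<^locale>\<open>vector_space\<close>).  The \<open>\<int>/2\<int>\<close>-grading is a family of subspaces
  indexed by \<^typ>\<open>bit\<close> (\<open>0\<close> = even, \<open>1\<close> = odd).
\<close>

definition koszul_sign :: "bit \<Rightarrow> bit \<Rightarrow> complex" where
  "koszul_sign i j = (if i * j = 1 then -1 else 1)"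

locale lie_superalgebra = vector_space scale
  for scale :: "complex \<Rightarrow> 'v::ab_group_add \<Rightarrow> 'v" +
  fixes V :: "bit \<Rightarrow> 'v set" and br :: "'v \<Rightarrow> 'v \<Rightarrow> 'v"
  assumes subspace_grade: "subspace (V i)"
    and grades_disjoint: "V 0 \<inter> V 1 = {0}"
    and grades_span: "\<exists>x0 \<in> V 0. \<exists>x1 \<in> V 1. x = x0 + x1"
    and bracket_linear_right: "Vector_Spaces.linear scale scale (\<lambda>y. br x y)"
    and bracket_linear_left: "Vector_Spaces.linear scale scale (\<lambda>x. br x y)"
    and bracket_graded: "x \<in> V i \<Longrightarrow> y \<in> V j \<Longrightarrow> br x y \<in> V (i + j)"
    and bracket_skew: "x \<in> V i \<Longrightarrow> y \<in> V j \<Longrightarrow> br x y = - scale (koszul_sign i j) (br y x)"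
    and bracket_jacobi: "x \<in> V i \<Longrightarrow> y \<in> V j \<Longrightarrow>
      br x (br y z) = br (br x y) z + scale (koszul_sign i j) (br y (br x z))"

definition lie_superalgebra_iso ::
    "(complex \<Rightarrow> 'v::ab_group_add \<Rightarrow> 'v) \<Rightarrow> (bit \<Rightarrow> 'v set) \<Rightarrow> ('v \<Rightarrow> 'v \<Rightarrow> 'v) \<Rightarrow>
     (complex \<Rightarrow> 'w::ab_group_add \<Rightarrow> 'w) \<Rightarrow> (bit \<Rightarrow> 'w set) \<Rightarrow> ('w \<Rightarrow> 'w \<Rightarrow> 'w) \<Rightarrow>
     ('v \<Rightarrow> 'w) \<Rightarrow> bool" where
  "lie_superalgebra_iso scale V br scale' V' br' \<Phi> \<longleftrightarrow>
     Vector_Spaces.linear scale scale' \<Phi> \<and> bij \<Phi> \<and> (\<forall>i. \<Phi> ` V i = V' i) \<and>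
     (\<forall>x y. \<Phi> (br x y) = br' (\<Phi> x) (\<Phi> y))"


section \<open>Bilinear forms, 2-cocycles and coboundaries\<close>

definition bilinear_form :: "(complex \<Rightarrow> 'v::ab_group_add \<Rightarrow> 'v) \<Rightarrow> ('v \<Rightarrow> 'v \<Rightarrow> complex) \<Rightarrow> bool" where
  "bilinear_form scale \<phi> \<longleftrightarrow>
     (\<forall>x. Vector_Spaces.linear scale (*) (\<lambda>y. \<phi> x y)) \<and>
     (\<forall>y. Vector_Spaces.linear scale (*) (\<lambda>x. \<phi> x y))"

definition super_skew_form :: "(bit \<Rightarrow> 'v set) \<Rightarrow> ('v \<Rightarrow> 'v \<Rightarrow> complex) \<Rightarrow> bool" where
  "super_skew_form V \<phi> \<longleftrightarrow>
     (\<forall>i j. \<forall>x \<in> V i. \<forall>y \<in> V j. \<phi> x y = - koszul_sign i j * \<phi> y x)"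

text \<open>
  The identities below say that \<open>[(x, s), (y, t)] = ([x, y], \<phi> x y)\<close> satisfies the super-skew-symmetry
  and Jacobi axioms on \<open>L \<oplus> \<complex>\<close>; see \<open>lie_superalgebra_central_extension_iff\<close> below.  Forms are
  not required to be homogeneous, so that every coboundary \<open>f([x, y])\<close>, for arbitrary linear \<open>f\<close>, is
  a cocycle; the cocycles for which the added central element is even are those that
  vanish on pairs of opposite parity.
\<close>

definition two_cocycle ::
    "(complex \<Rightarrow> 'v::ab_group_add \<Rightarrow> 'v) \<Rightarrow> (bit \<Rightarrow> 'v set) \<Rightarrow> ('v \<Rightarrow> 'v \<Rightarrow> 'v) \<Rightarrow>
     ('v \<Rightarrow> 'v \<Rightarrow> complex) \<Rightarrow> bool" where
  "two_cocycle scale V br \<phi> \<longleftrightarrow> bilinear_form scale \<phi> \<and> super_skew_form V \<phi> \<and>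
     (\<forall>i j. \<forall>x \<in> V i. \<forall>y \<in> V j. \<forall>z.
        \<phi> x (br y z) = \<phi> (br x y) z + koszul_sign i j * \<phi> y (br x z))"

definition coboundary ::
    "(complex \<Rightarrow> 'v::ab_group_add \<Rightarrow> 'v) \<Rightarrow> ('v \<Rightarrow> 'v \<Rightarrow> 'v) \<Rightarrow> ('v \<Rightarrow> 'v \<Rightarrow> complex) \<Rightarrow> bool" where
  "coboundary scale br \<phi> \<longleftrightarrow>
     (\<exists>f. Vector_Spaces.linear scale (*) f \<and> (\<forall>x y. \<phi> x y = f (br x y)))"

definition ext_scale :: "(complex \<Rightarrow> 'v \<Rightarrow> 'v) \<Rightarrow> complex \<Rightarrow> 'v \<times> complex \<Rightarrow> 'v \<times> complex" where
  "ext_scale scale t u = (scale t (fst u), t * snd u)"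

definition ext_grade :: "(bit \<Rightarrow> 'v set) \<Rightarrow> bit \<Rightarrow> ('v \<times> complex) set" where
  "ext_grade V i = V i \<times> (if i = 0 then UNIV else {0})"

definition ext_bracket ::
    "('v \<Rightarrow> 'v \<Rightarrow> 'v) \<Rightarrow> ('v \<Rightarrow> 'v \<Rightarrow> complex) \<Rightarrow> 'v \<times> complex \<Rightarrow> 'v \<times> complex \<Rightarrow> 'v \<times> complex" where
  "ext_bracket br \<phi> u v = (br (fst u) (fst v), \<phi> (fst u) (fst v))"

lemma linear_iff_laws:
  "Vector_Spaces.linear s1 s2 f \<longleftrightarrow> vector_space s1 \<and> vector_space s2 \<and>
     (\<forall>x y. f (x + y) = f x + f y) \<and> (\<forall>t x. f (s1 t x) = s2 t (f x))"
  by (auto simp: linear_iff_module_hom module_hom_iff module_iff_vector_space)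

lemma vector_space_complex: "vector_space ((*) :: complex \<Rightarrow> complex \<Rightarrow> complex)"
  by unfold_locales (auto simp: algebra_simps)

lemma lie_superalgebra_central_extension_iff:
  assumes A: "lie_superalgebra scale V br" and bil: "bilinear_form scale \<phi>"
  shows "lie_superalgebra (ext_scale scale) (ext_grade V) (ext_bracket br \<phi>) \<longleftrightarrow>
     two_cocycle scale V br \<phi> \<and> (\<forall>x \<in> V 0. \<forall>y \<in> V 1. \<phi> x y = 0)"
proof -
  interpret lie_superalgebra scale V br by (fact A)
  have phi_add: "\<phi> (x + x') y = \<phi> x y + \<phi> x' y" "\<phi> x (y + y') = \<phi> x y + \<phi> x y'"
    and phi_scale: "\<phi> (scale t x) y = t * \<phi> x y" "\<phi> x (scale t y) = t * \<phi> x y" for x x' y y' t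
    using bil unfolding bilinear_form_def linear_iff_laws by blast+
  have br_add: "br (x + x') y = br x y + br x' y" "br x (y + y') = br x y + br x y'"
    and br_scale: "br (scale t x) y = scale t (br x y)" "br x (scale t y) = scale t (br x y)"
    for x x' y y' t
    using bracket_linear_left bracket_linear_right unfolding linear_iff_laws by blast+
  have V0: "0 \<in> V i" for i
    using subspace_grade subspace_0 by blast
  have lift: "(x, 0) \<in> ext_grade V i \<longleftrightarrow> x \<in> V i" for x i
    by (simp add: ext_grade_def)
  have fst_grade: "u \<in> ext_grade V i \<Longrightarrow> fst u \<in> V i" for u i
    by (auto simp: ext_grade_def)
  have vs: "vector_space (ext_scale scale)"
    by unfold_locales
      (auto simp: ext_scale_def algebra_simps scale_right_distrib scale_left_distrib)
  show ?thesis
  proof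
    assume "lie_superalgebra (ext_scale scale) (ext_grade V) (ext_bracket br \<phi>)"
    then interpret E: lie_superalgebra "ext_scale scale" "ext_grade V" "ext_bracket br \<phi>" .
    have "\<phi> x y = - koszul_sign i j * \<phi> y x" if "x \<in> V i" "y \<in> V j" for i j x y
      using E.bracket_skew[of "(x, 0)" i "(y, 0)" j] that
      by (simp add: lift ext_bracket_def ext_scale_def)
    moreover have "\<phi> x (br y z) = \<phi> (br x y) z + koszul_sign i j * \<phi> y (br x z)"
      if "x \<in> V i" "y \<in> V j" for i j x y z
      using E.bracket_jacobi[of "(x, 0)" i "(y, 0)" j "(z, 0)"] that
      by (simp add: lift ext_bracket_def ext_scale_def)
    moreover have "\<phi> x y = 0" if "x \<in> V 0" "y \<in> V 1" for x y
      using E.bracket_graded[of "(x, 0)" 0 "(y, 0)" 1] that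
      by (simp add: lift) (simp add: ext_grade_def ext_bracket_def)
    ultimately show "two_cocycle scale V br \<phi> \<and> (\<forall>x \<in> V 0. \<forall>y \<in> V 1. \<phi> x y = 0)"
      using bil unfolding two_cocycle_def super_skew_form_def by blast
  next
    assume "two_cocycle scale V br \<phi> \<and> (\<forall>x \<in> V 0. \<forall>y \<in> V 1. \<phi> x y = 0)"
    then have skew: "\<And>i j x y. x \<in> V i \<Longrightarrow> y \<in> V j \<Longrightarrow> \<phi> x y = - koszul_sign i j * \<phi> y x"
      and jac: "\<And>i j x y z. x \<in> V i \<Longrightarrow> y \<in> V j \<Longrightarrow>
        \<phi> x (br y z) = \<phi> (br x y) z + koszul_sign i j * \<phi> y (br x z)"
      and even: "\<And>x y. x \<in> V 0 \<Longrightarrow> y \<in> V 1 \<Longrightarrow> \<phi> x y = 0"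
      unfolding two_cocycle_def super_skew_form_def by blast+
    have mixed: "\<phi> x y = 0" if "x \<in> V i" "y \<in> V j" "i + j = 1" for x y i j
      using that even[of x y] even[of y x] skew[of x i y j] by (cases i; cases j) auto
    show "lie_superalgebra (ext_scale scale) (ext_grade V) (ext_bracket br \<phi>)"
    proof (intro lie_superalgebra.intro vs lie_superalgebra_axioms.intro)
      interpret X: vector_space "ext_scale scale" by (fact vs)
      show "X.subspace (ext_grade V i)" for i
        using subspace_grade[of i] unfolding subspace_def X.subspace_def
        by (auto simp: ext_grade_def ext_scale_def zero_prod_def)
      show "ext_grade V 0 \<inter> ext_grade V 1 = {0}"
        using grades_disjoint by (auto simp: ext_grade_def zero_prod_def)
      show "\<exists>x0 \<in> ext_grade V 0. \<exists>x1 \<in> ext_grade V 1. x = x0 + x1" for x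
      proof -
        obtain x0 x1 where "x0 \<in> V 0" "x1 \<in> V 1" "fst x = x0 + x1"
          using grades_span by blast
        then have "(x0, snd x) \<in> ext_grade V 0" "(x1, 0) \<in> ext_grade V 1"
          "x = (x0, snd x) + (x1, 0)"
          by (auto simp: ext_grade_def prod_eq_iff)
        then show ?thesis by blast
      qed
      show "Vector_Spaces.linear (ext_scale scale) (ext_scale scale) (ext_bracket br \<phi> x)" for x
        by (simp add: linear_iff_laws vs)
          (auto simp: ext_bracket_def ext_scale_def br_add br_scale phi_add phi_scale)
      show "Vector_Spaces.linear (ext_scale scale) (ext_scale scale) (\<lambda>x. ext_bracket br \<phi> x y)" for y
        by (simp add: linear_iff_laws vs)
          (auto simp: ext_bracket_def ext_scale_def br_add br_scale phi_add phi_scale)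
      show "ext_bracket br \<phi> x y \<in> ext_grade V (i + j)"
        if "x \<in> ext_grade V i" "y \<in> ext_grade V j" for x i y j
        using bracket_graded[OF that[THEN fst_grade]] mixed[OF that[THEN fst_grade]]
        by (auto simp: ext_bracket_def ext_grade_def)
      show "ext_bracket br \<phi> x y = - ext_scale scale (koszul_sign i j) (ext_bracket br \<phi> y x)"
        if "x \<in> ext_grade V i" "y \<in> ext_grade V j" for x i y j
        using bracket_skew[OF that[THEN fst_grade]] skew[OF that[THEN fst_grade]]
        by (simp add: ext_bracket_def ext_scale_def)
      show "ext_bracket br \<phi> x (ext_bracket br \<phi> y z) =
          ext_bracket br \<phi> (ext_bracket br \<phi> x y) z +
          ext_scale scale (koszul_sign i j) (ext_bracket br \<phi> y (ext_bracket br \<phi> x z))"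
        if "x \<in> ext_grade V i" "y \<in> ext_grade V j" for x i y j z
        using bracket_jacobi[OF that[THEN fst_grade]] jac[OF that[THEN fst_grade]]
        by (simp add: ext_bracket_def ext_scale_def)
    qed
  qed
qed


section \<open>Super-extensions of the Heisenberg-Virasoro type algebra\<close>

definition basis_family ::
    "(complex \<Rightarrow> 'v::ab_group_add \<Rightarrow> 'v) \<Rightarrow> ('i \<Rightarrow> 'v) \<Rightarrow> 'v set \<Rightarrow> bool" where
  "basis_family scale e W \<longleftrightarrow>
     inj e \<and> \<not> module.dependent scale (range e) \<and> module.span scale (range e) = W"

definition super_extension ::
    "(complex \<Rightarrow> 'v::ab_group_add \<Rightarrow> 'v) \<Rightarrow> (bit \<Rightarrow> 'v set) \<Rightarrow> ('v \<Rightarrow> 'v \<Rightarrow> 'v) \<Rightarrow>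
     (int \<Rightarrow> 'v) \<Rightarrow> (int \<Rightarrow> 'v) \<Rightarrow> (int \<Rightarrow> 'v) \<Rightarrow> (int \<Rightarrow> 'v) \<Rightarrow> bool" where
  "super_extension scale V br L H Gp Gm \<longleftrightarrow>
     lie_superalgebra scale V br \<and>
     basis_family scale (case_sum L H) (V 0) \<and>
     basis_family scale (case_sum Gp Gm) (V 1) \<and>
     (\<forall>m n. br (L m) (L n) = scale (of_int (m - n)) (L (m + n))) \<and>
     (\<forall>m n. br (H m) (H n) = 0) \<and>
     (\<forall>m n. br (L m) (H n) = scale (- of_int n) (H (m + n))) \<and>
     (\<exists>ap am bp bm f1 f2. (f1, f2) \<noteq> (0, 0) \<and>
        (\<forall>m i. br (L m) (Gp i) = scale (ap - of_int i + of_int m * bp) (Gp (m + i))) \<and>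
        (\<forall>m i. br (L m) (Gm i) = scale (am - of_int i + of_int m * bm) (Gm (m + i))) \<and>
        (\<forall>n i. br (H n) (Gp i) = scale f1 (Gp (n + i))) \<and>
        (\<forall>n i. br (H n) (Gm i) = scale f2 (Gm (n + i)))) \<and>
     (\<forall>X \<in> {Gp, Gm}. \<forall>Y \<in> {Gp, Gm}. \<forall>i j.
        br (X i) (Y j) \<in> module.span scale {L (i + j), H (i + j)})"

definition nontrivial_super_extension ::
    "(complex \<Rightarrow> 'v::ab_group_add \<Rightarrow> 'v) \<Rightarrow> (bit \<Rightarrow> 'v set) \<Rightarrow> ('v \<Rightarrow> 'v \<Rightarrow> 'v) \<Rightarrow>
     (int \<Rightarrow> 'v) \<Rightarrow> (int \<Rightarrow> 'v) \<Rightarrow> (int \<Rightarrow> 'v) \<Rightarrow> (int \<Rightarrow> 'v) \<Rightarrow> bool" where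
  "nontrivial_super_extension scale V br L H Gp Gm \<longleftrightarrow>
     super_extension scale V br L H Gp Gm \<and> (\<exists>x \<in> V 1. \<exists>y \<in> V 1. br x y \<noteq> 0)"


section \<open>The superalgebras \<open>L(b)\<close> with central element \<open>c\<^sub>H\<close>\<close>

datatype hat_index = IL int | IH int | IGp int | IGm int | IC

text \<open>The complex vector space with basis \<^typ>\<open>hat_index\<close>.\<close>

type_synonym hat = "hat_index \<Rightarrow>\<^sub>0 complex"

abbreviation hat_monom :: "hat_index \<Rightarrow> complex \<Rightarrow> hat" where
  "hat_monom \<equiv> Poly_Mapping.single"

definition hat_scale :: "complex \<Rightarrow> hat \<Rightarrow> hat" where
  "hat_scale t x = Poly_Mapping.map (\<lambda>a. t * a) x"

fun index_parity :: "hat_index \<Rightarrow> bit" where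
  "index_parity (IGp k) = 1"
| "index_parity (IGm k) = 1"
| "index_parity _ = 0"

definition hat_grade :: "bit \<Rightarrow> hat set" where
  "hat_grade i = {x. \<forall>p \<in> Poly_Mapping.keys x. index_parity p = i}"

definition kdelta :: "int \<Rightarrow> complex" where
  "kdelta n = (if n = 0 then 1 else 0)"

definition coeff_LL :: "complex \<Rightarrow> int \<Rightarrow> complex" where
  "coeff_LL b i = of_int (i ^ 3 - i) * (b - b\<^sup>2)"

definition coeff_LH :: "complex \<Rightarrow> int \<Rightarrow> complex" where
  "coeff_LH b i = of_int (i * (i - 1)) / 2 * (1 - 2 * b)"

definition coeff_GG :: "complex \<Rightarrow> int \<Rightarrow> complex" where
  "coeff_GG b i = (of_int i * (of_int i + 1 - 2 * b) + b\<^sup>2 - b) / 2"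

fun hat_table :: "complex \<Rightarrow> hat_index \<Rightarrow> hat_index \<Rightarrow> hat" where
  "hat_table b (IL i) (IL j) =
     hat_monom (IL (i + j)) (of_int (i - j)) + hat_monom IC (coeff_LL b i * kdelta (i + j))"
| "hat_table b (IL i) (IH j) =
     hat_monom (IH (i + j)) (- of_int j) + hat_monom IC (coeff_LH b i * kdelta (i + j))"
| "hat_table b (IH j) (IL i) =
     - (hat_monom (IH (i + j)) (- of_int j) + hat_monom IC (coeff_LH b i * kdelta (i + j)))"
| "hat_table b (IH i) (IH j) = hat_monom IC (of_int i * kdelta (i + j))"
| "hat_table b (IL i) (IGp j) = hat_monom (IGp (i + j)) (- of_int j + of_int i * (1 - b))"
| "hat_table b (IGp j) (IL i) = - hat_monom (IGp (i + j)) (- of_int j + of_int i * (1 - b))"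
| "hat_table b (IL i) (IGm j) = hat_monom (IGm (i + j)) (- of_int j + of_int i * b)"
| "hat_table b (IGm j) (IL i) = - hat_monom (IGm (i + j)) (- of_int j + of_int i * b)"
| "hat_table b (IH i) (IGp j) = hat_monom (IGp (i + j)) 1"
| "hat_table b (IGp j) (IH i) = - hat_monom (IGp (i + j)) 1"
| "hat_table b (IH i) (IGm j) = - hat_monom (IGm (i + j)) 1"
| "hat_table b (IGm j) (IH i) = hat_monom (IGm (i + j)) 1"
| "hat_table b (IGm i) (IGp j) =
     hat_monom (IL (i + j)) 1 + hat_monom (IH (i + j)) (- of_int i + of_int (i + j) * b)
     + hat_monom IC (coeff_GG b i * kdelta (i + j))"
| "hat_table b (IGp j) (IGm i) =
     hat_monom (IL (i + j)) 1 + hat_monom (IH (i + j)) (- of_int i + of_int (i + j) * b)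
     + hat_monom IC (coeff_GG b i * kdelta (i + j))"
| "hat_table b (IGp i) (IGp j) = 0"
| "hat_table b (IGm i) (IGm j) = 0"
| "hat_table b IC q = 0"
| "hat_table b p IC = 0"

definition hat_bracket :: "complex \<Rightarrow> hat \<Rightarrow> hat \<Rightarrow> hat" where
  "hat_bracket b x y =
     (\<Sum>p \<in> Poly_Mapping.keys x. \<Sum>q \<in> Poly_Mapping.keys y.
        hat_scale (Poly_Mapping.lookup x p * Poly_Mapping.lookup y q) (hat_table b p q))"

lemma hat_bracket_monom: "hat_bracket b (hat_monom p 1) (hat_monom q 1) = hat_table b p q"
  by (rule poly_mapping_eqI) (simp add: hat_bracket_def hat_scale_def Poly_Mapping.map.rep_eq when_def)


section \<open>The quotient by the line spanned by \<open>c\<^sub>H\<close>\<close>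

definition hat_center_rel :: "hat \<Rightarrow> hat \<Rightarrow> bool" where
  "hat_center_rel x y \<longleftrightarrow> (\<exists>t. x - y = hat_scale t (hat_monom IC 1))"

lemma lookup_hat_scale [simp]:
  "Poly_Mapping.lookup (hat_scale t x) p = t * Poly_Mapping.lookup x p"
  by (simp add: hat_scale_def Poly_Mapping.map.rep_eq when_def)

lemma hat_center_rel_iff:
  "hat_center_rel x y \<longleftrightarrow> (\<forall>p. p \<noteq> IC \<longrightarrow> Poly_Mapping.lookup x p = Poly_Mapping.lookup y p)"
proof
  assume "hat_center_rel x y"
  then obtain t where t: "x - y = hat_scale t (hat_monom IC 1)"
    unfolding hat_center_rel_def by blast
  show "\<forall>p. p \<noteq> IC \<longrightarrow> Poly_Mapping.lookup x p = Poly_Mapping.lookup y p"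
  proof (intro allI impI)
    fix p assume "p \<noteq> IC"
    have "Poly_Mapping.lookup (x - y) p = 0"
      using \<open>p \<noteq> IC\<close> unfolding t by (simp add: lookup_single when_def)
    then show "Poly_Mapping.lookup x p = Poly_Mapping.lookup y p"
      by (simp add: lookup_minus)
  qed
next
  assume r: "\<forall>p. p \<noteq> IC \<longrightarrow> Poly_Mapping.lookup x p = Poly_Mapping.lookup y p"
  have "x - y = hat_scale (Poly_Mapping.lookup (x - y) IC) (hat_monom IC 1)"
    by (rule poly_mapping_eqI) (use r in \<open>auto simp: lookup_minus lookup_single when_def\<close>)
  then show "hat_center_rel x y"
    unfolding hat_center_rel_def by blast
qed

lemma hat_bracket_cong_center:
  assumes "hat_center_rel x x'" and "hat_center_rel y y'"
  shows "hat_bracket b x y = hat_bracket b x' y'"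
proof -
  have zero: "hat_scale t 0 = 0" for t
    by (rule poly_mapping_eqI) simp
  have table: "hat_table b p IC = 0" for p
    by (cases p) auto
  have drop: "hat_bracket b u v =
      (\<Sum>p \<in> Poly_Mapping.keys u - {IC}. \<Sum>q \<in> Poly_Mapping.keys v - {IC}.
         hat_scale (Poly_Mapping.lookup u p * Poly_Mapping.lookup v q) (hat_table b p q))" for u v
    unfolding hat_bracket_def
    by (intro sum.mono_neutral_cong_right) (auto simp: zero table intro!: sum.mono_neutral_right)
  have "Poly_Mapping.keys x - {IC} = Poly_Mapping.keys x' - {IC}"
    and "Poly_Mapping.keys y - {IC} = Poly_Mapping.keys y' - {IC}"
    using assms by (auto simp: hat_center_rel_iff in_keys_iff)
  then show ?thesis
    unfolding drop using assms by (auto simp: hat_center_rel_iff intro!: sum.cong)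
qed

quotient_type hat_quot = hat / hat_center_rel
  by (rule equivpI) (auto simp: reflp_def symp_def transp_def hat_center_rel_iff)

instantiation hat_quot :: ab_group_add
begin

lift_definition zero_hat_quot :: hat_quot is "0" .

lift_definition plus_hat_quot :: "hat_quot \<Rightarrow> hat_quot \<Rightarrow> hat_quot" is "(+)"
  by (simp add: hat_center_rel_iff lookup_add)

lift_definition minus_hat_quot :: "hat_quot \<Rightarrow> hat_quot \<Rightarrow> hat_quot" is "(-)"
  by (simp add: hat_center_rel_iff lookup_minus)

lift_definition uminus_hat_quot :: "hat_quot \<Rightarrow> hat_quot" is "uminus"
  by (simp add: hat_center_rel_iff)

instance
  by standard (transfer; simp add: hat_center_rel_iff lookup_add lookup_minus algebra_simps)+

end

lift_definition quot_scale :: "complex \<Rightarrow> hat_quot \<Rightarrow> hat_quot" is hat_scale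
  by (simp add: hat_center_rel_iff)

lift_definition quot_bracket :: "complex \<Rightarrow> hat_quot \<Rightarrow> hat_quot \<Rightarrow> hat_quot" is hat_bracket
  by (metis hat_bracket_cong_center hat_center_rel_iff)

definition quot_proj :: "hat \<Rightarrow> hat_quot" where
  "quot_proj = abs_hat_quot"

lemma quot_proj_eq_iff: "quot_proj x = quot_proj y \<longleftrightarrow> hat_center_rel x y"
  by (simp add: quot_proj_def hat_quot.abs_eq_iff)

lemma quot_proj_hom:
  "quot_proj (x + y) = quot_proj x + quot_proj y"
  "quot_proj (hat_scale t x) = quot_scale t (quot_proj x)"
  "quot_proj (hat_bracket b x y) = quot_bracket b (quot_proj x) (quot_proj y)"
  by (simp_all add: quot_proj_def plus_hat_quot.abs_eq quot_scale.abs_eq quot_bracket.abs_eq)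

definition quot_grade :: "bit \<Rightarrow> hat_quot set" where
  "quot_grade i = quot_proj ` hat_grade i"

abbreviation quot_basis :: "hat_index \<Rightarrow> hat_quot" where
  "quot_basis p \<equiv> quot_proj (hat_monom p 1)"

text \<open>
  The form \<open>\<psi>\<close> with parameter \<open>\<kappa>\<close>; the values below, together with bilinearity and
  super-skew-symmetry, determine it uniquely, since the classes of the \<open>L\<^sub>i\<close>, \<open>H\<^sub>i\<close>, \<open>G\<^sub>i\<^sup>+\<close>, \<open>G\<^sub>i\<^sup>-\<close>
  form a basis of the quotient.
\<close>

definition is_psi_form :: "complex \<Rightarrow> complex \<Rightarrow> (hat_quot \<Rightarrow> hat_quot \<Rightarrow> complex) \<Rightarrow> bool" where
  "is_psi_form b \<kappa> \<psi> \<longleftrightarrow>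
     bilinear_form quot_scale \<psi> \<and> super_skew_form quot_grade \<psi> \<and>
     (\<forall>i j.
        \<psi> (quot_basis (IL i)) (quot_basis (IL j)) = coeff_LL b i * \<kappa> * kdelta (i + j) \<and>
        \<psi> (quot_basis (IL i)) (quot_basis (IH j)) = coeff_LH b i * \<kappa> * kdelta (i + j) \<and>
        \<psi> (quot_basis (IH i)) (quot_basis (IH j)) = of_int i * \<kappa> * kdelta (i + j) \<and>
        \<psi> (quot_basis (IGm i)) (quot_basis (IGp j)) = coeff_GG b i * \<kappa> * kdelta (i + j) \<and>
        \<psi> (quot_basis (IL i)) (quot_basis (IGp j)) = 0 \<and>
        \<psi> (quot_basis (IL i)) (quot_basis (IGm j)) = 0 \<and>
        \<psi> (quot_basis (IH i)) (quot_basis (IGp j)) = 0 \<and>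
        \<psi> (quot_basis (IH i)) (quot_basis (IGm j)) = 0 \<and>
        \<psi> (quot_basis (IGp i)) (quot_basis (IGp j)) = 0 \<and>
        \<psi> (quot_basis (IGm i)) (quot_basis (IGm j)) = 0)"

end

theory Submission
  imports Defs
begin

text \<open>
  The pairing of \<open>G\<^sup>-\<close> with \<open>G\<^sup>+\<close> governs everything: its values determine the rest of the
  algebra, and the same computation determines the cocycles.

  That \<open>L(b)\<close> is a Lie superalgebra (\<open>lie_superalgebra_hat\<close>) is an identity between structure
  constants, because both sides of each axiom are linear in every argument.

  For the classification, compare the two ways in which \<open>H\<^sub>0\<close> acts on an odd bracket \<open>[X\<^sub>i, Y\<^sub>j]\<close>:
  it kills \<open>L\<^sub>k\<close> and \<open>H\<^sub>k\<close>, but multiplies the bracket by the sum of the charges of \<open>X\<close> and \<open>Y\<close>, the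
  scalars by which \<open>H\<^sub>0\<close> acts on the two families.  So a bracket survives only between families of
  opposite charge.  A family of charge zero could only pair with itself; the other family would then
  be charged and would detect this pairing, which must therefore vanish.  Hence the charges of
  \<open>G\<^sup>+\<close> and \<open>G\<^sup>-\<close> are \<open>f\<close> and \<open>-f\<close> with \<open>f \<noteq> 0\<close>, and only \<open>[G\<^sup>-, G\<^sup>+]\<close> is nonzero.  Write
  \<open>[G\<^sup>-\<^sub>i, G\<^sup>+\<^sub>j] = c\<^sub>i\<^sub>j L\<^sub>i\<^sub>+\<^sub>j + d\<^sub>i\<^sub>j H\<^sub>i\<^sub>+\<^sub>j\<close>.  The odd Jacobi identity \<open>[G\<^sup>-\<^sub>i, [G\<^sup>-\<^sub>i, G\<^sup>+\<^sub>j]] = 0\<close> expresses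
  \<open>d\<^sub>i\<^sub>j\<close> through \<open>c\<^sub>i\<^sub>j\<close>, the action of the \<open>H\<^sub>n\<close> makes \<open>c\<^sub>i\<^sub>j\<close> a function of \<open>i + j\<close>, and the action of
  the \<open>L\<^sub>m\<close> gives a recursion whose only nonzero solutions are constants \<open>C\<close>, and only for
  \<open>a\<^sup>- + a\<^sup>+ = 0\<close>, \<open>b\<^sup>- + b\<^sup>+ = 1\<close> (\<open>mixed_bracket_form\<close>).  The change of basis
  \<open>L\<^sub>k + (a\<^sup>-/f) H\<^sub>k\<close>, \<open>H\<^sub>k / f\<close>, \<open>G\<^sup>+\<^sub>k / C\<close>, \<open>G\<^sup>-\<^sub>k\<close> then absorbs \<open>a\<^sup>-\<close>, \<open>f\<close> and \<open>C\<close> and leaves the bracket of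
  \<open>L(b)\<close> modulo \<open>c\<^sub>H\<close> with \<open>b = b\<^sup>-\<close> (\<open>normal_form_homomorphism\<close>).

  For the cocycles, note that \<open>\<psi>\<close> is \<open>\<kappa>\<close> times the \<open>c\<^sub>H\<close>-coordinate of the bracket of two lifts to
  \<open>L(b)\<close>.  It is therefore enough that every 2-cocycle of \<open>L(b)\<close> itself is a coboundary \<open>f([x, y])\<close>
  (\<open>hat_cocycle_is_coboundary\<close>): a cocycle of the quotient is pulled back to \<open>L(b)\<close>, and splitting
  \<open>f\<close> into \<open>f(c\<^sub>H)\<close> times the \<open>c\<^sub>H\<close>-coordinate and a functional that kills \<open>c\<^sub>H\<close> gives \<open>\<psi>\<close> with
  \<open>\<kappa> = f(c\<^sub>H)\<close> plus a coboundary of the quotient (\<open>iso_and_cocycles_of_center_quotient\<close>).  The brackets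
  \<open>[G\<^sup>-\<^sub>i, G\<^sup>+\<^sub>j]\<close> and \<open>[H\<^sub>0, G\<^sup>\<plusminus>\<^sub>k]\<close> span \<open>L(b)\<close>, and a cocycle that vanishes on these pairs vanishes
  identically, so \<open>f\<close> has only to match the cocycle there.
\<close>

section \<open>Linear extension from the basis\<close>

abbreviation mon :: "hat_index \<Rightarrow> hat" where
  "mon p \<equiv> hat_monom p 1"

definition lin_ext ::
    "(complex \<Rightarrow> 'w::ab_group_add \<Rightarrow> 'w) \<Rightarrow> (hat_index \<Rightarrow> 'w) \<Rightarrow> hat \<Rightarrow> 'w" where
  "lin_ext s e x = (\<Sum>p \<in> Poly_Mapping.keys x. s (Poly_Mapping.lookup x p) (e p))"

lemma vector_space_hat: "vector_space hat_scale"
  by unfold_locales (auto intro!: poly_mapping_eqI simp: lookup_add algebra_simps)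

interpretation hat: vector_space hat_scale
  by (rule vector_space_hat)

lemma linearI:
  assumes "vector_space s" "vector_space s'"
    "\<And>x y. f (x + y) = f x + f y" "\<And>t x. f (s t x) = s' t (f x)"
  shows "Vector_Spaces.linear s s' f"
  using assms by (simp add: linear_iff_laws)

lemma linearD:
  assumes "Vector_Spaces.linear s s' f"
  shows "f (x + y) = f x + f y" "f (s t x) = s' t (f x)" "f 0 = 0" "f (- x) = - f x"
    "f (x - y) = f x - f y" "f (sum g A) = (\<Sum>a\<in>A. f (g a))"
proof -
  interpret Vector_Spaces.linear s s' f by fact
  show "f (x + y) = f x + f y" "f (s t x) = s' t (f x)" "f 0 = 0" "f (- x) = - f x"
    "f (x - y) = f x - f y" "f (sum g A) = (\<Sum>a\<in>A. f (g a))"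
    by (auto simp: add scale zero neg diff sum)
qed

lemma hat_scale_monom [simp]: "hat_scale t (hat_monom p a) = hat_monom p (t * a)"
  by (rule poly_mapping_eqI) (simp add: lookup_single when_def)

lemma monom_eq_scale: "hat_monom p a = hat_scale a (mon p)"
  by simp

lemma hat_expand:
  "x = (\<Sum>p \<in> Poly_Mapping.keys x. hat_scale (Poly_Mapping.lookup x p) (mon p))"
proof (rule poly_mapping_eqI)
  fix k
  show "Poly_Mapping.lookup x k = Poly_Mapping.lookup
    (\<Sum>p \<in> Poly_Mapping.keys x. hat_scale (Poly_Mapping.lookup x p) (mon p)) k"
    by (simp add: lookup_sum lookup_single when_def in_keys_iff)
qed

text \<open>
  Agreement is only required on the basis vectors that occur in \<open>x\<close>, so that identities valid for
  homogeneous arguments can be extended one argument at a time.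
\<close>

lemma linear_eq_on_keys:
  assumes f: "Vector_Spaces.linear hat_scale s f" and g: "Vector_Spaces.linear hat_scale s g"
    and eq: "\<And>p. p \<in> Poly_Mapping.keys x \<Longrightarrow> f (mon p) = g (mon p)"
  shows "f x = g x"
proof -
  have "f x = (\<Sum>p \<in> Poly_Mapping.keys x. s (Poly_Mapping.lookup x p) (f (mon p)))"
    by (subst hat_expand[of x]) (simp only: linearD(2,6)[OF f])
  also have "\<dots> = (\<Sum>p \<in> Poly_Mapping.keys x. s (Poly_Mapping.lookup x p) (g (mon p)))"
    using eq by simp
  also have "\<dots> = g x"
    by (subst (3) hat_expand[of x]) (simp only: linearD(2,6)[OF g])
  finally show ?thesis .
qed

lemma lin_ext_superset:
  assumes "vector_space s" "finite A" "Poly_Mapping.keys x \<subseteq> A"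
  shows "lin_ext s e x = (\<Sum>p \<in> A. s (Poly_Mapping.lookup x p) (e p))"
proof -
  interpret vector_space s by fact
  show ?thesis
    unfolding lin_ext_def using assms
    by (intro sum.mono_neutral_left) (auto simp: in_keys_iff)
qed

lemma linear_lin_ext:
  assumes "vector_space s"
  shows "Vector_Spaces.linear hat_scale s (lin_ext s e)"
proof (rule linearI[OF vector_space_hat assms])
  interpret vector_space s by fact
  fix x y :: hat and t
  let ?A = "Poly_Mapping.keys x \<union> Poly_Mapping.keys y"
  show "lin_ext s e (x + y) = lin_ext s e x + lin_ext s e y"
    using keys_add[of x y]
    by (subst (1 2 3) lin_ext_superset[OF assms, of ?A])
      (auto simp: lookup_add scale_left_distrib sum.distrib)
  show "lin_ext s e (hat_scale t x) = s t (lin_ext s e x)"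
    by (subst (1 2) lin_ext_superset[OF assms, of "Poly_Mapping.keys x"])
      (auto simp: in_keys_iff scale_sum_right)
qed

lemma lin_ext_mon:
  assumes "vector_space s"
  shows "lin_ext s e (mon p) = e p"
proof -
  interpret vector_space s by fact
  show ?thesis by (simp add: lin_ext_def)
qed

section \<open>The bracket of \<open>L(b)\<close>\<close>

lemma hat_bracket_lin_ext:
  "hat_bracket b x y = lin_ext hat_scale (\<lambda>p. lin_ext hat_scale (hat_table b p) y) x"
  unfolding hat_bracket_def lin_ext_def by (simp add: hat.scale_sum_right)

lemma linear_hat_bracket_left: "Vector_Spaces.linear hat_scale hat_scale (\<lambda>x. hat_bracket b x y)"
  unfolding hat_bracket_lin_ext by (rule linear_lin_ext[OF vector_space_hat])

lemma linear_hat_bracket_right: "Vector_Spaces.linear hat_scale hat_scale (hat_bracket b x)"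
proof (rule linearI[OF vector_space_hat vector_space_hat])
  note lin = linearD(1,2)[OF linear_lin_ext[OF vector_space_hat]]
  show "hat_bracket b x (y + z) = hat_bracket b x y + hat_bracket b x z" for y z
    unfolding hat_bracket_lin_ext lin by (simp add: lin_ext_def hat.scale_right_distrib sum.distrib)
  show "hat_bracket b x (hat_scale t y) = hat_scale t (hat_bracket b x y)" for t y
    unfolding hat_bracket_lin_ext lin by (simp add: lin_ext_def hat.scale_sum_right mult.left_commute)
qed

lemmas hat_bracket_simps =
  linearD(1-5)[OF linear_hat_bracket_left] linearD(1-5)[OF linear_hat_bracket_right]

lemma hat_bracket_monom_coeffs:
  "hat_bracket b (hat_monom p s) (hat_monom q t) = hat_scale (s * t) (hat_table b p q)"
proof -
  have "hat_bracket b (hat_monom p s) (hat_monom q t) =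
      hat_scale s (hat_scale t (hat_bracket b (mon p) (mon q)))"
    by (metis (no_types) hat_bracket_simps(2,7) monom_eq_scale)
  then show ?thesis by (simp add: hat_bracket_monom)
qed

text \<open>
  After expansion both sides are combinations of the same basis vectors.  The coefficients of
  \<open>L\<close>, \<open>H\<close> and \<open>G\<^sup>\<plusminus>\<close> agree as polynomials in the indices and \<open>b\<close>; the coefficients of \<open>c\<^sub>H\<close> only matter
  when the three indices add up to \<open>0\<close>, and agree once one index is eliminated by
  that relation.
\<close>

lemma hat_table_jacobi:
  "hat_bracket b (mon p) (hat_table b q r) = hat_bracket b (hat_table b p q) (mon r)
    + hat_scale (koszul_sign (index_parity p) (index_parity q)) (hat_bracket b (mon q) (hat_table b p r))"
proof -
  have last_index: "P" if "u + v = - w" "w = - u - v \<Longrightarrow> P" for u v w :: int and P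
    using that by simp
  note coeffs = kdelta_def coeff_LL_def coeff_LH_def coeff_GG_def
  show ?thesis
    apply (cases p; cases q; cases r)
    apply (simp_all add: koszul_sign_def hat_bracket_simps hat_bracket_monom_coeffs)
    apply (auto intro!: poly_mapping_eqI simp: coeffs lookup_single when_def lookup_add lookup_minus
       field_simps add_eq_0_iff power2_eq_square power3_eq_cube)
    \<comment> \<open>What remains are the \<open>c\<^sub>H\<close>-coordinates in total degree \<open>0\<close>.\<close>
    apply (erule last_index, hypsubst, simp add: algebra_simps)+
    done
qed

lemma hat_table_skew:
  "hat_table b p q = - hat_scale (koszul_sign (index_parity p) (index_parity q)) (hat_table b q p)"
  by (cases p; cases q)
    (auto intro!: poly_mapping_eqI simp: koszul_sign_def coeff_LL_def power3_eq_cube kdelta_def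
      lookup_single when_def lookup_add algebra_simps add_eq_0_iff)

lemma hat_table_graded:
  "Poly_Mapping.keys (hat_table b p q) \<subseteq> {r. index_parity r = index_parity p + index_parity q}"
  by (cases p; cases q)
    (auto simp: lookup_single lookup_add lookup_minus in_keys_iff when_def split: if_splits)

lemma subspace_hat_grade: "hat.subspace (hat_grade i)"
  unfolding hat.subspace_def hat_grade_def by (auto simp: in_keys_iff lookup_add)

lemma hat_bracket_graded:
  assumes "x \<in> hat_grade i" "y \<in> hat_grade j"
  shows "hat_bracket b x y \<in> hat_grade (i + j)"
  unfolding hat_bracket_def
proof (intro hat.subspace_sum[OF subspace_hat_grade] hat.subspace_scale[OF subspace_hat_grade])
  fix p q assume "p \<in> Poly_Mapping.keys x" "q \<in> Poly_Mapping.keys y"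
  then show "hat_table b p q \<in> hat_grade (i + j)"
    using assms hat_table_graded[of b p q] by (auto simp: hat_grade_def)
qed

lemmas hat_linear_simps =
  linear_iff_laws vector_space_hat hat_bracket_simps hat.scale_right_distrib mult.commute

lemma hat_bracket_skew:
  assumes "x \<in> hat_grade i" "y \<in> hat_grade j"
  shows "hat_bracket b x y = - hat_scale (koszul_sign i j) (hat_bracket b y x)"
proof -
  let ?s = "hat_scale (koszul_sign i j)"
  have "hat_bracket b (mon p) y = - ?s (hat_bracket b y (mon p))"
    if "p \<in> Poly_Mapping.keys x" for p
  proof (rule linear_eq_on_keys[where s = hat_scale and x = y and
        f = "\<lambda>y. hat_bracket b (mon p) y" and g = "\<lambda>y. - ?s (hat_bracket b y (mon p))"])
    show "hat_bracket b (mon p) (mon q) = - ?s (hat_bracket b (mon q) (mon p))"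
      if "q \<in> Poly_Mapping.keys y" for q
      using hat_table_skew[of b p q] that \<open>p \<in> _\<close> assms
      by (auto simp: hat_bracket_monom hat_grade_def)
  qed (auto simp: hat_linear_simps)
  then show ?thesis
    by (intro linear_eq_on_keys[where s = hat_scale and x = x and
        f = "\<lambda>x. hat_bracket b x y" and g = "\<lambda>x. - ?s (hat_bracket b y x)"])
      (auto simp: hat_linear_simps)
qed

lemma hat_bracket_jacobi:
  assumes "x \<in> hat_grade i" "y \<in> hat_grade j"
  shows "hat_bracket b x (hat_bracket b y z) = hat_bracket b (hat_bracket b x y) z
    + hat_scale (koszul_sign i j) (hat_bracket b y (hat_bracket b x z))"
proof -
  let ?l = "\<lambda>x y z. hat_bracket b x (hat_bracket b y z)"
  let ?r = "\<lambda>x y z. hat_bracket b (hat_bracket b x y) z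
    + hat_scale (koszul_sign i j) (hat_bracket b y (hat_bracket b x z))"
  have pqr: "?l (mon p) (mon q) (mon r) = ?r (mon p) (mon q) (mon r)"
    if "p \<in> Poly_Mapping.keys x" "q \<in> Poly_Mapping.keys y" for p q r
    using hat_table_jacobi[of b p q r] that assms by (auto simp: hat_bracket_monom hat_grade_def)
  have pq: "?l (mon p) (mon q) z = ?r (mon p) (mon q) z"
    if "p \<in> Poly_Mapping.keys x" "q \<in> Poly_Mapping.keys y" for p q
    by (rule linear_eq_on_keys[where s = hat_scale and x = z and
          f = "?l (mon p) (mon q)" and g = "?r (mon p) (mon q)"])
      (use pqr[OF that] in \<open>auto simp: hat_linear_simps\<close>)
  have p: "?l (mon p) y z = ?r (mon p) y z" if "p \<in> Poly_Mapping.keys x" for p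
    by (rule linear_eq_on_keys[where s = hat_scale and x = y and
          f = "\<lambda>y. ?l (mon p) y z" and g = "\<lambda>y. ?r (mon p) y z"])
      (use pq[OF that] in \<open>auto simp: hat_linear_simps\<close>)
  show "?l x y z = ?r x y z"
    by (rule linear_eq_on_keys[where s = hat_scale and x = x and
          f = "\<lambda>x. ?l x y z" and g = "\<lambda>x. ?r x y z"])
      (use p in \<open>auto simp: hat_linear_simps\<close>)
qed

lemma lie_superalgebra_hat: "lie_superalgebra hat_scale hat_grade (hat_bracket b)"
proof (intro lie_superalgebra.intro lie_superalgebra_axioms.intro vector_space_hat)
  show "hat_grade 0 \<inter> hat_grade 1 = {0}"
    by (auto simp: hat_grade_def simp flip: keys_eq_empty)
  show "\<exists>x0 \<in> hat_grade 0. \<exists>x1 \<in> hat_grade 1. x = x0 + x1" for x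
  proof -
    let ?part = "\<lambda>i. \<Sum>p \<in> {p \<in> Poly_Mapping.keys x. index_parity p = i}.
      hat_scale (Poly_Mapping.lookup x p) (mon p)"
    have "?part i \<in> hat_grade i" for i
      by (intro hat.subspace_sum[OF subspace_hat_grade] hat.subspace_scale[OF subspace_hat_grade])
        (auto simp: hat_grade_def)
    moreover have "x = ?part 0 + ?part 1"
    proof -
      let ?K = "\<lambda>i. {p \<in> Poly_Mapping.keys x. index_parity p = i}"
      have "index_parity p = 0 \<or> index_parity p = 1" for p
        by (cases p) auto
      then have "Poly_Mapping.keys x = ?K 0 \<union> ?K 1" and "?K 0 \<inter> ?K 1 = {}"
        by auto
      then show ?thesis
        using hat_expand[of x]
          sum.union_disjoint[of "?K 0" "?K 1" "\<lambda>p. hat_scale (Poly_Mapping.lookup x p) (mon p)"]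
        by (metis (lifting) finite_Un finite_keys)
    qed
    ultimately show ?thesis by blast
  qed
qed (rule subspace_hat_grade linear_hat_bracket_left linear_hat_bracket_right
    hat_bracket_graded hat_bracket_skew hat_bracket_jacobi; assumption)+

section \<open>Two-cocycles of \<open>L(b)\<close>\<close>

lemma bilinear_formD:
  assumes "bilinear_form s \<phi>"
  shows "\<phi> (x + x') y = \<phi> x y + \<phi> x' y" "\<phi> (s t x) y = t * \<phi> x y" "\<phi> 0 y = 0" "\<phi> (- x) y = - \<phi> x y"
    "\<phi> (x - x') y = \<phi> x y - \<phi> x' y"
    "\<phi> x (y + y') = \<phi> x y + \<phi> x y'" "\<phi> x (s t y) = t * \<phi> x y" "\<phi> x 0 = 0" "\<phi> x (- y) = - \<phi> x y"
    "\<phi> x (y - y') = \<phi> x y - \<phi> x y'"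
proof -
  have r: "Vector_Spaces.linear s (*) (\<phi> x)" and l: "Vector_Spaces.linear s (*) (\<lambda>x. \<phi> x y)" for x y
    using assms unfolding bilinear_form_def by auto
  show "\<phi> (x + x') y = \<phi> x y + \<phi> x' y" "\<phi> (s t x) y = t * \<phi> x y" "\<phi> 0 y = 0" "\<phi> (- x) y = - \<phi> x y"
    "\<phi> (x - x') y = \<phi> x y - \<phi> x' y"
    "\<phi> x (y + y') = \<phi> x y + \<phi> x y'" "\<phi> x (s t y) = t * \<phi> x y" "\<phi> x 0 = 0" "\<phi> x (- y) = - \<phi> x y"
    "\<phi> x (y - y') = \<phi> x y - \<phi> x y'"
    using linearD[OF l] linearD[OF r] by auto
qed

lemma two_cocycle_minus_coboundary:
  assumes A: "lie_superalgebra s V br" and \<phi>: "two_cocycle s V br \<phi>"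
    and f: "Vector_Spaces.linear s (*) f"
  shows "two_cocycle s V br (\<lambda>x y. \<phi> x y - f (br x y))"
proof -
  interpret lie_superalgebra s V br by (fact A)
  have bil: "bilinear_form s \<phi>"
    and skew: "\<And>i j x y. x \<in> V i \<Longrightarrow> y \<in> V j \<Longrightarrow> \<phi> x y = - koszul_sign i j * \<phi> y x"
    and jac: "\<And>i j x y z. x \<in> V i \<Longrightarrow> y \<in> V j \<Longrightarrow>
        \<phi> x (br y z) = \<phi> (br x y) z + koszul_sign i j * \<phi> y (br x z)"
    using \<phi> unfolding two_cocycle_def super_skew_form_def by blast+
  note lin = linearD[OF bracket_linear_left] linearD[OF bracket_linear_right] linearD[OF f]
    bilinear_formD[OF bil]
  have "bilinear_form s (\<lambda>x y. \<phi> x y - f (br x y))"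
    unfolding bilinear_form_def linear_iff_laws
    by (simp add: vector_space_axioms vector_space_complex lin algebra_simps)
  moreover have "\<phi> x y - f (br x y) = - koszul_sign i j * (\<phi> y x - f (br y x))"
    if "x \<in> V i" "y \<in> V j" for i j x y
    by (subst bracket_skew[OF that], subst skew[OF that]) (simp add: lin algebra_simps)
  moreover have "\<phi> x (br y z) - f (br x (br y z)) = \<phi> (br x y) z - f (br (br x y) z)
      + koszul_sign i j * (\<phi> y (br x z) - f (br y (br x z)))"
    if "x \<in> V i" "y \<in> V j" for i j x y z
    by (subst bracket_jacobi[OF that], subst jac[OF that]) (simp add: lin algebra_simps)
  ultimately show ?thesis
    unfolding two_cocycle_def super_skew_form_def by blast
qed

text \<open>The guard keeps the simplifier from rewriting basis vectors to themselves.\<close>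

lemma linear_monom:
  assumes "Vector_Spaces.linear hat_scale (*) g" "NO_MATCH 1 a"
  shows "g (hat_monom p a) = a * g (mon p)"
  using linearD(2)[OF assms(1), of a "mon p"] by simp

lemma functional_eq_0_if_basis:
  fixes g :: "hat \<Rightarrow> complex"
  assumes "Vector_Spaces.linear hat_scale (*) g" "\<And>p. g (mon p) = 0"
  shows "g x = 0"
proof -
  have "Vector_Spaces.linear hat_scale (*) (\<lambda>_. 0 :: complex)"
    by (simp add: linear_iff_laws vector_space_hat vector_space_complex)
  from linear_eq_on_keys[OF assms(1) this] assms(2) show ?thesis by simp
qed

text \<open>
  The brackets \<open>[G\<^sup>-\<^sub>i, G\<^sup>+\<^sub>j]\<close> together with the \<open>G\<^sup>\<plusminus>\<^sub>k\<close> span \<open>L(b)\<close>: for fixed \<open>k = i + j\<close> the bracket is a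
  polynomial in \<open>i\<close>, with \<open>H\<^sub>k\<close> in its linear coefficient and, for \<open>k = 0\<close>, with \<open>c\<^sub>H\<close> alone in its
  quadratic coefficient.
\<close>

lemma hat_functional_eq_0I:
  fixes g :: "hat \<Rightarrow> complex"
  assumes g: "Vector_Spaces.linear hat_scale (*) g"
    and GG: "\<And>i j. g (hat_table b (IGm i) (IGp j)) = 0"
    and G: "\<And>k. g (mon (IGp k)) = 0" "\<And>k. g (mon (IGm k)) = 0"
  shows "g x = 0"
proof -
  have *: "g (mon (IL k)) + (- of_int i + of_int k * b) * g (mon (IH k))
      + coeff_GG b i * kdelta k * g (mon IC) = 0" for i k
    using GG[of i "k - i"]
    by (simp add: linearD[OF g] linear_monom[OF g])
  have C: "g (mon IC) = 0"
  proof -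
    \<comment> \<open>The second difference in \<open>i\<close> isolates the quadratic coefficient.\<close>
    have "g (mon IC) = (coeff_GG b 1 + coeff_GG b (- 1) - 2 * coeff_GG b 0) * g (mon IC)"
      by (simp add: coeff_GG_def field_simps)
    also have "\<dots> = 0"
      using *[where k = 0, of 1] *[where k = 0, of 0] *[where k = 0, of "- 1"]
      by (simp add: kdelta_def) algebra
    finally show ?thesis .
  qed
  then have LH: "g (mon (IL k)) + (- of_int i + of_int k * b) * g (mon (IH k)) = 0" for i k
    using * by simp
  have H: "g (mon (IH k)) = 0" for k
    using LH[of k 0] LH[of k 1] by (simp add: algebra_simps)
  then have L: "g (mon (IL k)) = 0" for k
    using LH by simp
  have "g (mon p) = 0" for p
    by (cases p) (auto simp: L H C G)
  then show ?thesis
    by (rule functional_eq_0_if_basis[OF g])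
qed

lemma mon_graded: "mon p \<in> hat_grade (index_parity p)"
  by (simp add: hat_grade_def)

lemma hat_cocycleD:
  assumes "two_cocycle hat_scale hat_grade (hat_bracket b) \<phi>"
  shows "\<phi> (mon p) (mon q) = - koszul_sign (index_parity p) (index_parity q) * \<phi> (mon q) (mon p)"
    and "\<phi> (mon p) (hat_table b q r) = \<phi> (hat_table b p q) (mon r)
      + koszul_sign (index_parity p) (index_parity q) * \<phi> (mon q) (hat_table b p r)"
    and "Vector_Spaces.linear hat_scale (*) (\<phi> x)"
    and "Vector_Spaces.linear hat_scale (*) (\<lambda>y. \<phi> y x)"
proof -
  show "\<phi> (mon p) (hat_table b q r) = \<phi> (hat_table b p q) (mon r)
      + koszul_sign (index_parity p) (index_parity q) * \<phi> (mon q) (hat_table b p r)"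
    using assms mon_graded[of p] mon_graded[of q] unfolding two_cocycle_def
    by (metis hat_bracket_monom)
  show "\<phi> (mon p) (mon q) = - koszul_sign (index_parity p) (index_parity q) * \<phi> (mon q) (mon p)"
    using assms mon_graded[of p] mon_graded[of q]
    unfolding two_cocycle_def super_skew_form_def by blast
  show "Vector_Spaces.linear hat_scale (*) (\<phi> x)"
    "Vector_Spaces.linear hat_scale (*) (\<lambda>y. \<phi> y x)"
    using assms unfolding two_cocycle_def bilinear_form_def by blast+
qed

lemma koszul_sign_simps [simp]:
  "koszul_sign 0 i = 1" "koszul_sign i 0 = 1" "koszul_sign 1 1 = -1"
  by (simp_all add: koszul_sign_def)

text \<open>
  All consequences come from the charge, the eigenvalue of \<open>H\<^sub>0\<close>, which is \<open>0\<close> on even basis vectors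
  and \<open>\<plusminus>1\<close> on \<open>G\<^sup>\<plusminus>\<close>.  Inserting \<open>H\<^sub>0\<close> into the cocycle identity kills \<open>\<chi>(G\<^sup>+, G\<^sup>+)\<close>, \<open>\<chi>(G\<^sup>-, G\<^sup>-)\<close> and the
  pairs of opposite parity; then \<open>\<chi>(x, [G\<^sup>-\<^sub>i, G\<^sup>+\<^sub>j])\<close> reduces for even \<open>x\<close> to odd pairs, and these
  brackets span the even part.
\<close>

lemma hat_cocycle_eq_0I:
  assumes \<chi>: "two_cocycle hat_scale hat_grade (hat_bracket b) \<chi>"
    and GG: "\<And>i j. \<chi> (mon (IGm i)) (mon (IGp j)) = 0"
    and HG: "\<And>k. \<chi> (mon (IH 0)) (mon (IGp k)) = 0" "\<And>k. \<chi> (mon (IH 0)) (mon (IGm k)) = 0"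
  shows "\<chi> x y = 0"
proof -
  note D = hat_cocycleD[OF \<chi>]
  note lin = linearD[OF D(3)] linearD[OF D(4)] linear_monom[OF D(3)] linear_monom[OF D(4)]
  have pp: "\<chi> (mon (IGp i)) (mon (IGp j)) = 0" for i j
    using D(2)[of "IH 0" "IGp i" "IGp j"] by (simp add: lin)
  have mm: "\<chi> (mon (IGm i)) (mon (IGm j)) = 0" for i j
    using D(2)[of "IH 0" "IGm i" "IGm j"] by (simp add: lin)
  have pm: "\<chi> (mon (IGp i)) (mon (IGm j)) = 0" for i j
    using D(1)[of "IGp i" "IGm j"] GG by simp
  note odd_odd = pp mm pm GG
  have H0: "hat_table b (IH 0) p = 0" if "index_parity p = 0" for p
    using that by (cases p) (auto simp: kdelta_def coeff_LH_def)
  have even_p: "\<chi> (mon p) (mon (IGp k)) = 0" and even_m: "\<chi> (mon p) (mon (IGm k)) = 0"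
    if "index_parity p = 0" for p k
  proof -
    have "\<chi> (mon (IH 0)) (hat_table b p (IGp k)) = 0" "\<chi> (mon (IH 0)) (hat_table b p (IGm k)) = 0"
      using that by (cases p; simp add: lin HG)+
    then show "\<chi> (mon p) (mon (IGp k)) = 0" "\<chi> (mon p) (mon (IGm k)) = 0"
      using D(2)[of "IH 0" p "IGp k"] D(2)[of "IH 0" p "IGm k"] H0[OF that] that by (auto simp: lin)
  qed
  have even: "\<chi> (mon p) y = 0" if p: "index_parity p = 0" for p y
  proof (rule hat_functional_eq_0I[OF D(3)])
    show "\<chi> (mon p) (hat_table b (IGm i) (IGp j)) = 0" for i j
      using D(2)[of p "IGm i" "IGp j"] p
      by (cases p) (simp_all add: lin odd_odd)
  qed (use p even_p even_m in auto)
  have "\<chi> (mon p) (mon q) = 0" for p q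
  proof (cases "index_parity p = 0 \<or> index_parity q = 0")
    case True
    then show ?thesis using even[of p] even[of q] D(1)[of p q] by auto
  next
    case False
    then show ?thesis by (cases p; cases q) (auto simp: odd_odd)
  qed
  then have "\<chi> (mon p) y = 0" for p
    by (rule functional_eq_0_if_basis[OF D(3)])
  then show ?thesis
    by (rule functional_eq_0_if_basis[OF D(4)])
qed

text \<open>
  A functional \<open>f\<close> has to satisfy \<open>\<phi>(G\<^sup>-\<^sub>i, G\<^sup>+\<^sub>j) = f([G\<^sup>-\<^sub>i, G\<^sup>+\<^sub>j])\<close> and \<open>\<phi>(H\<^sub>0, G\<^sup>\<plusminus>\<^sub>k) = \<plusminus> f(G\<^sup>\<plusminus>\<^sub>k)\<close>.  The
  second condition defines \<open>f\<close> on the odd part.  In degree \<open>k = i + j \<noteq> 0\<close> the first one is solved by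
  inserting the grading element \<open>L\<^sub>0\<close> into the cocycle identity.  In degree \<open>0\<close> the insertion of \<open>H\<^sub>1\<close>
  shows that \<open>\<phi>(G\<^sup>-\<^sub>i, G\<^sup>+\<^sub>-\<^sub>i)\<close> is a quadratic polynomial in \<open>i\<close>; its three coefficients are matched by
  the values of \<open>f\<close> at \<open>L\<^sub>0\<close>, \<open>H\<^sub>0\<close> and \<open>c\<^sub>H\<close>.
\<close>

theorem hat_cocycle_is_coboundary:
  assumes \<phi>: "two_cocycle hat_scale hat_grade (hat_bracket b) \<phi>"
  shows "coboundary hat_scale (hat_bracket b) \<phi>"
proof -
  note D = hat_cocycleD[OF \<phi>]
  note lin = linearD[OF D(3)] linearD[OF D(4)] linear_monom[OF D(3)] linear_monom[OF D(4)]
  \<comment> \<open>A central element pairs to \<open>0\<close> with every bracket, and the brackets span.\<close>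
  have c_left: "\<phi> (mon IC) y = 0" for y
  proof (rule hat_functional_eq_0I[OF D(3)])
    show "\<phi> (mon IC) (hat_table b (IGm i) (IGp j)) = 0" for i j
      using D(2)[of IC "IGm i" "IGp j"] by (simp only: hat_table.simps lin) simp
    show "\<phi> (mon IC) (mon (IGp k)) = 0" "\<phi> (mon IC) (mon (IGm k)) = 0" for k
      using D(2)[of IC "IH 0" "IGp k"] D(2)[of IC "IH 0" "IGm k"] by (simp_all add: lin)
  qed
  have c_right: "\<phi> (mon p) (mon IC) = 0" for p
    using D(1)[of p IC] c_left by simp
  define S where "S i k = \<phi> (mon (IGm i)) (mon (IGp (k - i)))" for i k
  have grading: "\<phi> (mon (IL 0)) (mon (IL k)) + (- of_int i + of_int k * b) * \<phi> (mon (IL 0)) (mon (IH k))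
      = - of_int k * S i k" for i k
    using D(2)[of "IL 0" "IGm i" "IGp (k - i)"]
    by (simp add: lin S_def c_right algebra_simps)
  define \<kappa> where "\<kappa> = \<phi> (mon (IH 1)) (mon (IH (-1)))"
  define q where "q = \<phi> (mon (IH 1)) (mon (IL (-1)))"
  have S_step: "S (i + 1) 0 = S i 0 - q + (of_int i + b) * \<kappa>" for i
    using D(2)[of "IH 1" "IGm i" "IGp (- 1 - i)"]
    by (simp add: lin S_def q_def \<kappa>_def c_right algebra_simps)
  \<comment> \<open>The values of \<open>f\<close> at \<open>H\<^sub>0\<close> and \<open>L\<^sub>0\<close>, read off from the difference equation for \<open>S\<close> and from
    \<open>i = 0\<close>, given that \<open>f(c\<^sub>H) = \<kappa>\<close>.\<close>
  define h where "h = q + \<kappa> * (1 - 2 * b)"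
  define l where "l = S 0 0 - \<kappa> * coeff_GG b 0"
  have S0: "S i 0 = l - of_int i * h + coeff_GG b i * \<kappa>" for i
  proof (induction i rule: int_induct[where k = 0])
    case base
    show ?case by (simp add: l_def)
  next
    case (step1 i)
    then show ?case
      unfolding S_step by (simp add: h_def coeff_GG_def field_simps power2_eq_square)
  next
    case (step2 i)
    have S_pred: "S (i - 1) 0 = S i 0 + q - (of_int i - 1 + b) * \<kappa>"
      using S_step[of "i - 1"] by (simp add: algebra_simps)
    show ?case
      unfolding S_pred step2(2) by (simp add: h_def coeff_GG_def field_simps power2_eq_square)
  qed
  define F where "F p = (case p of IGp k \<Rightarrow> \<phi> (mon (IH 0)) (mon p) | IGm k \<Rightarrow> - \<phi> (mon (IH 0)) (mon p)
      | IL k \<Rightarrow> if k = 0 then l else - \<phi> (mon (IL 0)) (mon p) / of_int k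
      | IH k \<Rightarrow> if k = 0 then h else - \<phi> (mon (IL 0)) (mon p) / of_int k
      | IC \<Rightarrow> \<kappa>)" for p
  define f where "f = lin_ext (*) F"
  have f: "Vector_Spaces.linear hat_scale (*) f"
    unfolding f_def by (rule linear_lin_ext[OF vector_space_complex])
  have f_mon: "f (mon p) = F p" for p
    unfolding f_def by (rule lin_ext_mon[OF vector_space_complex])
  note f_simps = linearD[OF f] linear_monom[OF f] f_mon F_def
  have "\<phi> x y - f (hat_bracket b x y) = 0" for x y
  proof (rule hat_cocycle_eq_0I[OF two_cocycle_minus_coboundary[OF lie_superalgebra_hat \<phi> f]])
    show "\<phi> (mon (IGm i)) (mon (IGp j)) - f (hat_bracket b (mon (IGm i)) (mon (IGp j))) = 0" for i j
    proof (cases "i + j = 0")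
      case True
      then have "j = 0 - i" by simp
      then show ?thesis
        using S0[of i] by (simp add: S_def hat_bracket_monom f_simps kdelta_def)
    next
      case False
      let ?k = "of_int (i + j) :: complex" and ?d = "- of_int i + of_int (i + j) * b"
      let ?lL = "\<phi> (mon (IL 0)) (mon (IL (i + j)))" and ?lH = "\<phi> (mon (IL 0)) (mon (IH (i + j)))"
      have "f (hat_bracket b (mon (IGm i)) (mon (IGp j))) = F (IL (i + j)) + ?d * F (IH (i + j))"
        using False
        by (simp add: hat_bracket_monom linearD[OF f] linear_monom[OF f] f_mon kdelta_def)
      also have "\<dots> = - (?lL + ?d * ?lH) / ?k"
        using False unfolding F_def
        by (simp only: hat_index.case if_False) (simp add: diff_divide_distrib)
      also have "\<dots> = S i (i + j)"
      proof -
        have "?k \<noteq> 0"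
          using False by (simp only: of_int_eq_0_iff) simp
        then show ?thesis
          unfolding grading mult_minus_left minus_minus by (rule nonzero_mult_div_cancel_left)
      qed
      finally show ?thesis
        by (simp add: S_def)
    qed
  next
    show "\<phi> (mon (IH 0)) (mon (IGp k)) - f (hat_bracket b (mon (IH 0)) (mon (IGp k))) = 0"
      "\<phi> (mon (IH 0)) (mon (IGm k)) - f (hat_bracket b (mon (IH 0)) (mon (IGm k))) = 0" for k
      by (simp_all add: hat_bracket_monom linearD(1-5)[OF f] f_mon F_def)
  qed
  then have "\<phi> x y = f (hat_bracket b x y)" for x y
    by (metis eq_iff_diff_eq_0)
  then show ?thesis
    unfolding coboundary_def using f by blast
qed

section \<open>The quotient by the centre\<close>

lemma vector_space_quot: "vector_space quot_scale"
  by unfold_locales (transfer; simp add: hat_center_rel_iff lookup_add algebra_simps)+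

lemma quot_proj_surj: "\<exists>x. u = quot_proj x"
  by (induct u rule: hat_quot.abs_induct) (auto simp: quot_proj_def)

text \<open>
  Up to the factor \<open>\<kappa>\<close>, the form \<open>\<psi>\<close> is the defect of lifting the quotient into \<open>L(b)\<close>: the central part of the bracket of
  two lifts, which does not depend on the lifts because \<open>c\<^sub>H\<close> is central.
\<close>

lift_definition psi_form :: "complex \<Rightarrow> complex \<Rightarrow> hat_quot \<Rightarrow> hat_quot \<Rightarrow> complex"
  is "\<lambda>b \<kappa> x y. \<kappa> * Poly_Mapping.lookup (hat_bracket b x y) IC"
  by (metis hat_bracket_cong_center)

lemma psi_form_proj:
  "psi_form b \<kappa> (quot_proj x) (quot_proj y) = \<kappa> * Poly_Mapping.lookup (hat_bracket b x y) IC"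
  by (simp add: quot_proj_def psi_form.abs_eq)

lemma is_psi_form_psi_form: "is_psi_form b \<kappa> (psi_form b \<kappa>)"
proof -
  have "bilinear_form quot_scale (psi_form b \<kappa>)"
    unfolding bilinear_form_def linear_iff_laws
  proof (intro conjI allI vector_space_quot vector_space_complex)
    fix u v w :: hat_quot and t :: complex
    obtain x y z where "u = quot_proj x" "v = quot_proj y" "w = quot_proj z"
      using quot_proj_surj by metis
    then show "psi_form b \<kappa> u (v + w) = psi_form b \<kappa> u v + psi_form b \<kappa> u w"
      "psi_form b \<kappa> u (quot_scale t v) = t * psi_form b \<kappa> u v"
      "psi_form b \<kappa> (v + w) u = psi_form b \<kappa> v u + psi_form b \<kappa> w u"
      "psi_form b \<kappa> (quot_scale t v) u = t * psi_form b \<kappa> v u"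
      by (simp_all add: psi_form_proj hat_bracket_simps lookup_add distrib_left
          flip: quot_proj_hom(1,2))
  qed
  moreover have "super_skew_form quot_grade (psi_form b \<kappa>)"
    unfolding super_skew_form_def
  proof (intro allI ballI)
    fix i j u v assume "u \<in> quot_grade i" "v \<in> quot_grade j"
    then obtain x y where x: "x \<in> hat_grade i" "u = quot_proj x" and y: "y \<in> hat_grade j" "v = quot_proj y"
      unfolding quot_grade_def by blast
    show "psi_form b \<kappa> u v = - koszul_sign i j * psi_form b \<kappa> v u"
      unfolding x(2) y(2) psi_form_proj hat_bracket_skew[OF x(1) y(1)] by simp
  qed
  ultimately show ?thesis
    unfolding is_psi_form_def
    by (simp add: psi_form_proj hat_bracket_monom lookup_add lookup_single)
qed

text \<open>
  Any superalgebra onto which \<open>L(b)\<close> maps, preserving the grading, with kernel \<open>\<complex>c\<^sub>H\<close> is the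
  quotient, and its cocycles pull back to coboundaries \<open>f([x, y])\<close> on \<open>L(b)\<close>.  Such an \<open>f\<close> need not
  vanish on \<open>c\<^sub>H\<close>; the part of \<open>f\<close> that does not descend is \<open>f(c\<^sub>H)\<close> times the \<open>c\<^sub>H\<close>-coordinate, and
  this is what becomes \<open>\<psi>\<close>.
\<close>

theorem iso_and_cocycles_of_center_quotient:
  fixes s :: "complex \<Rightarrow> 'v::ab_group_add \<Rightarrow> 'v" and \<Psi> :: "hat \<Rightarrow> 'v"
  assumes V: "lie_superalgebra s V br"
    and lin: "Vector_Spaces.linear hat_scale s \<Psi>"
    and hom: "\<And>x y. \<Psi> (hat_bracket b x y) = br (\<Psi> x) (\<Psi> y)"
    and grade: "\<And>i. \<Psi> ` hat_grade i = V i"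
    and ker: "\<And>x. \<Psi> x = 0 \<longleftrightarrow> hat_center_rel x 0"
  shows "\<exists>\<Phi>. lie_superalgebra_iso s V br quot_scale quot_grade (quot_bracket b) \<Phi> \<and>
    (\<forall>\<phi>. two_cocycle s V br \<phi> \<longrightarrow>
      (\<exists>\<kappa> \<psi>. is_psi_form b \<kappa> \<psi> \<and> coboundary s br (\<lambda>x y. \<phi> x y - \<psi> (\<Phi> x) (\<Phi> y))))"
proof -
  interpret lie_superalgebra s V br by (fact V)
  note L = linearD[OF lin]
  define pre where "pre v = (SOME x. \<Psi> x = v)" for v
  have "\<exists>x. \<Psi> x = v" for v
  proof -
    obtain v0 v1 where "v0 \<in> V 0" "v1 \<in> V 1" "v = v0 + v1"
      using grades_span by blast
    then show ?thesis using grade L(1) by (metis imageE)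
  qed
  then have pre: "\<Psi> (pre v) = v" for v
    unfolding pre_def by (rule someI_ex)
  have ker': "\<Psi> x = \<Psi> y \<longleftrightarrow> hat_center_rel x y" for x y
    using ker[of "x - y"] by (simp add: L hat_center_rel_def)
  define \<Phi> where "\<Phi> v = quot_proj (pre v)" for v
  have \<Phi>: "\<Phi> (\<Psi> x) = quot_proj x" for x
    unfolding \<Phi>_def quot_proj_eq_iff ker'[symmetric] by (rule pre)
  have "lie_superalgebra_iso s V br quot_scale quot_grade (quot_bracket b) \<Phi>"
    unfolding lie_superalgebra_iso_def linear_iff_laws
  proof (intro conjI allI vector_space_axioms vector_space_quot)
    fix v w t
    show "\<Phi> (v + w) = \<Phi> v + \<Phi> w"
      using \<Phi>[of "pre v + pre w"] by (simp add: L pre quot_proj_hom \<Phi>_def)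
    show "\<Phi> (s t v) = quot_scale t (\<Phi> v)"
      using \<Phi>[of "hat_scale t (pre v)"] by (simp add: L pre quot_proj_hom \<Phi>_def)
    show "\<Phi> (br v w) = quot_bracket b (\<Phi> v) (\<Phi> w)"
      using \<Phi>[of "hat_bracket b (pre v) (pre w)"] by (simp add: hom pre quot_proj_hom \<Phi>_def)
  next
    show "bij \<Phi>"
    proof (rule bijI')
      show "\<Phi> v = \<Phi> w \<longleftrightarrow> v = w" for v w
        unfolding \<Phi>_def quot_proj_eq_iff ker'[symmetric] pre ..
      show "\<exists>v. u = \<Phi> v" for u
        using quot_proj_surj[of u] \<Phi> by metis
    qed
    show "\<Phi> ` V i = quot_grade i" for i
      unfolding quot_grade_def grade[symmetric] image_image \<Phi> ..
  qed
  moreover have "\<exists>\<kappa> \<psi>. is_psi_form b \<kappa> \<psi> \<and> coboundary s br (\<lambda>x y. \<phi> x y - \<psi> (\<Phi> x) (\<Phi> y))"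
    if \<phi>: "two_cocycle s V br \<phi>" for \<phi>
  proof -
    have bil: "bilinear_form s \<phi>"
      and skew: "\<And>i j x y. x \<in> V i \<Longrightarrow> y \<in> V j \<Longrightarrow> \<phi> x y = - koszul_sign i j * \<phi> y x"
      and jac: "\<And>i j x y z. x \<in> V i \<Longrightarrow> y \<in> V j \<Longrightarrow>
        \<phi> x (br y z) = \<phi> (br x y) z + koszul_sign i j * \<phi> y (br x z)"
      using \<phi> unfolding two_cocycle_def super_skew_form_def by blast+
    have in_V: "\<Psi> x \<in> V i" if "x \<in> hat_grade i" for x i
      using that grade by blast
    have "two_cocycle hat_scale hat_grade (hat_bracket b) (\<lambda>x y. \<phi> (\<Psi> x) (\<Psi> y))"
      unfolding two_cocycle_def super_skew_form_def
    proof (intro conjI allI ballI)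
      show "bilinear_form hat_scale (\<lambda>x y. \<phi> (\<Psi> x) (\<Psi> y))"
        unfolding bilinear_form_def linear_iff_laws
        by (simp add: vector_space_hat vector_space_complex L bilinear_formD[OF bil])
    next
      fix i j x y z assume x: "x \<in> hat_grade i" and y: "y \<in> hat_grade j"
      show "\<phi> (\<Psi> x) (\<Psi> y) = - koszul_sign i j * \<phi> (\<Psi> y) (\<Psi> x)"
        by (rule skew[OF in_V[OF x] in_V[OF y]])
      show "\<phi> (\<Psi> x) (\<Psi> (hat_bracket b y z)) = \<phi> (\<Psi> (hat_bracket b x y)) (\<Psi> z)
          + koszul_sign i j * \<phi> (\<Psi> y) (\<Psi> (hat_bracket b x z))"
        unfolding hom by (rule jac[OF in_V[OF x] in_V[OF y]])
    qed
    then obtain f where f: "Vector_Spaces.linear hat_scale (*) f"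
      and f_br: "\<And>x y. \<phi> (\<Psi> x) (\<Psi> y) = f (hat_bracket b x y)"
      using hat_cocycle_is_coboundary unfolding coboundary_def by blast
    define \<kappa> where "\<kappa> = f (mon IC)"
    define g where "g x = f x - \<kappa> * Poly_Mapping.lookup x IC" for x
    have g: "g (x + y) = g x + g y" "g (hat_scale t x) = t * g x" for x y t
      by (simp_all add: g_def linearD[OF f] lookup_add algebra_simps)
    have g_ker: "g x = g y" if "\<Psi> x = \<Psi> y" for x y
    proof -
      obtain t where "x - y = hat_scale t (mon IC)"
        using \<open>\<Psi> x = \<Psi> y\<close> unfolding ker' hat_center_rel_def by blast
      then have "x = y + hat_scale t (mon IC)"
        by (simp add: algebra_simps)
      moreover have "g (mon IC) = 0"
        by (simp add: g_def \<kappa>_def)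
      ultimately show ?thesis by (simp only: g) simp
    qed
    define h where "h v = g (pre v)" for v
    have h: "h (\<Psi> x) = g x" for x
      unfolding h_def by (rule g_ker) (rule pre)
    have "Vector_Spaces.linear s (*) h"
    proof (rule linearI[OF vector_space_axioms vector_space_complex])
      show "h (v + w) = h v + h w" for v w
        using h[of "pre v + pre w"] by (simp add: L pre g h_def)
      show "h (s t v) = t * h v" for t v
        using h[of "hat_scale t (pre v)"] by (simp add: L pre g h_def)
    qed
    moreover have "\<phi> v w - psi_form b \<kappa> (\<Phi> v) (\<Phi> w) = h (br v w)" for v w
    proof -
      have "h (br v w) = g (hat_bracket b (pre v) (pre w))"
        using h[of "hat_bracket b (pre v) (pre w)"] by (simp add: hom pre)
      then show ?thesis
        using f_br[of "pre v" "pre w"] by (simp add: pre \<Phi>_def psi_form_proj g_def)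
    qed
    ultimately show ?thesis
      unfolding coboundary_def using is_psi_form_psi_form by blast
  qed
  ultimately show ?thesis by blast
qed

section \<open>The structure constants of a super-extension\<close>

text \<open>
  The recursion is the \<open>L\<^sub>m\<close>-equivariance of \<open>[X\<^sub>i, Y\<^sub>j] = C\<^sub>i\<^sub>+\<^sub>j L\<^sub>i\<^sub>+\<^sub>j + \<dots>\<close>, with \<open>A = a\<^sub>X + a\<^sub>Y\<close> and
  \<open>B = b\<^sub>X + b\<^sub>Y\<close>.  Taking \<open>m = 0\<close> gives \<open>A\<close>, taking \<open>k = 0\<close> relates every \<open>C\<^sub>m\<close> to \<open>C\<^sub>0\<close>, and the vanishing
  of the left side at \<open>k = m = 1\<close> forces \<open>B = 1\<close>.
\<close>

lemma structure_constants_rigid: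
  fixes C :: "int \<Rightarrow> complex"
  assumes rec: "\<And>k m. C k * of_int (m - k) = C (k + m) * (A - of_int k + of_int m * B)"
    and nz: "C k0 \<noteq> 0"
  shows "A = 0" "B = 1" "C k = C 0" "C 0 \<noteq> 0"
proof -
  show A: "A = 0"
    using rec[of k0 0] nz by (simp add: algebra_simps)
  have C0: "C 0 = B * C m" if "m \<noteq> 0" for m
    using rec[of 0 m] that A by (simp add: algebra_simps)
  have "C 0 \<noteq> 0"
  proof
    assume "C 0 = 0"
    then have "k0 \<noteq> 0" using nz by auto
    then show False
      using rec[of k0 "- k0"] nz \<open>C 0 = 0\<close> by simp
  qed
  then show "C 0 \<noteq> 0" .
  have "C 2 * (B - 1) = 0"
    using rec[of 1 1] A by (simp add: algebra_simps)
  then show B: "B = 1"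
    using C0[of 2] \<open>C 0 \<noteq> 0\<close> by auto
  show "C k = C 0"
    using C0[of k] B by (cases "k = 0") auto
qed

text \<open>
  The hypotheses are those of a super-extension as seen from one odd family \<open>X\<close>, with the other
  family \<open>Y\<close> as a partner.  Instantiating \<open>(X, Y)\<close> with both \<open>(G\<^sup>-, G\<^sup>+)\<close> and \<open>(G\<^sup>+, G\<^sup>-)\<close> makes each
  argument available for either sign.
\<close>

locale odd_intermediate_series = lie_superalgebra s V br
  for s :: "complex \<Rightarrow> 'v::ab_group_add \<Rightarrow> 'v" and V br +
  fixes L H X Y :: "int \<Rightarrow> 'v" and aX bX fX aY bY fY :: complex
  assumes L_even: "L m \<in> V 0" and H_even: "H m \<in> V 0"
    and X_odd: "X i \<in> V 1"
    and X_nonzero: "X i \<noteq> 0" and Y_nonzero: "Y i \<noteq> 0"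
    and LH_independent: "s c (L k) + s d (H k) = 0 \<Longrightarrow> c = 0 \<and> d = 0"
    and LL: "br (L m) (L n) = s (of_int (m - n)) (L (m + n))"
    and HH: "br (H m) (H n) = 0"
    and LH: "br (L m) (H n) = s (- of_int n) (H (m + n))"
    and LX: "br (L m) (X i) = s (aX - of_int i + of_int m * bX) (X (m + i))"
    and LY: "br (L m) (Y i) = s (aY - of_int i + of_int m * bY) (Y (m + i))"
    and HX: "br (H n) (X i) = s fX (X (n + i))"
    and HY: "br (H n) (Y i) = s fY (Y (n + i))"
    and XX_span: "\<exists>c d. br (X i) (X j) = s c (L (i + j)) + s d (H (i + j))"
    and XY_span: "\<exists>c d. br (X i) (Y j) = s c (L (i + j)) + s d (H (i + j))"
begin

lemmas br_simps = linearD(1-5)[OF bracket_linear_left] linearD(1-5)[OF bracket_linear_right]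

lemma bracket_swap_even: "x \<in> V 0 \<Longrightarrow> y \<in> V j \<Longrightarrow> br y x = - br x y"
  using bracket_skew[of y j x 0] by simp

lemma jacobi_even: "x \<in> V 0 \<Longrightarrow> y \<in> V j \<Longrightarrow> br x (br y z) = br (br x y) z + br y (br x z)"
  using bracket_jacobi[of x 0 y j z] by simp

lemma jacobi_odd: "x \<in> V 1 \<Longrightarrow> y \<in> V 1 \<Longrightarrow> br x (br y z) = br (br x y) z - br y (br x z)"
  using bracket_jacobi[of x 1 y 1 z] by simp

lemma HL: "br (H n) (L m) = s (of_int n) (H (m + n))"
  using bracket_swap_even[OF L_even H_even, of n m] by (simp add: LH)

lemma XL: "br (X i) (L m) = - s (aX - of_int i + of_int m * bX) (X (m + i))"
  using bracket_swap_even[OF L_even X_odd, of i m] by (simp add: LX)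

lemma XH: "br (X i) (H n) = - s fX (X (n + i))"
  using bracket_swap_even[OF H_even X_odd, of i n] by (simp add: HX)

lemma H0_LH_zero: "br (H 0) (s c (L k) + s d (H k)) = 0"
  by (simp add: br_simps HL HH)

text \<open>
  The operator \<open>[H\<^sub>0, _]\<close> multiplies \<open>[X\<^sub>i, X\<^sub>j]\<close> by \<open>2f\<^sub>X\<close>, but annihilates every \<open>L\<^sub>k\<close> and \<open>H\<^sub>k\<close>.
\<close>

lemma XX_zero_if: "fX \<noteq> 0 \<Longrightarrow> br (X i) (X j) = 0"
proof -
  assume "fX \<noteq> 0"
  have "s (fX + fX) (br (X i) (X j)) = br (H 0) (br (X i) (X j))"
    unfolding jacobi_even[OF H_even X_odd] HX scale_left_distrib by (simp add: br_simps)
  also have "\<dots> = 0"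
    using XX_span[of i j] H0_LH_zero by metis
  finally show ?thesis using \<open>fX \<noteq> 0\<close> by simp
qed

lemma XY_zero_if: "fX + fY \<noteq> 0 \<Longrightarrow> br (X i) (Y j) = 0"
proof -
  assume nz: "fX + fY \<noteq> 0"
  have "s (fX + fY) (br (X i) (Y j)) = br (H 0) (br (X i) (Y j))"
    unfolding jacobi_even[OF H_even X_odd] HX HY scale_left_distrib by (simp add: br_simps)
  also have "\<dots> = 0"
    using XY_span[of i j] H0_LH_zero by metis
  finally show ?thesis using nz by simp
qed

text \<open>
  As \<open>X\<close> does not pair with \<open>Y\<close>, the Jacobi identity makes \<open>[X\<^sub>i, X\<^sub>j]\<close> commute with every \<open>Y\<^sub>l\<close>.  An element \<open>cL\<^sub>k + dH\<^sub>k\<close> acts on \<open>Y\<^sub>l\<close> by a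
  scalar that is affine in \<open>l\<close> with slope \<open>-c\<close>; so \<open>c = 0\<close>, and \<open>d = 0\<close> since \<open>Y\<close> is charged.
\<close>

lemma XX_zero_if_Y_charged:
  assumes "fY \<noteq> 0" and XY: "\<And>i j. br (X i) (Y j) = 0"
  shows "br (X i) (X j) = 0"
proof -
  obtain c d where cd: "br (X i) (X j) = s c (L (i + j)) + s d (H (i + j))"
    using XX_span by blast
  have "c * (aY - of_int l + of_int (i + j) * bY) + d * fY = 0" for l
  proof -
    have "br (br (X i) (X j)) (Y l) = 0"
      using jacobi_odd[OF X_odd X_odd, of i j "Y l"] by (simp add: XY br_simps)
    then have "s (c * (aY - of_int l + of_int (i + j) * bY) + d * fY) (Y (i + j + l)) = 0"
      unfolding cd by (simp add: br_simps LY HY flip: scale_left_distrib)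
    then show ?thesis using Y_nonzero by simp
  qed
  note eq = this[of 0] this[of 1]
  then have "c = 0" by (simp add: algebra_simps)
  with eq \<open>fY \<noteq> 0\<close> have "d = 0" by simp
  with \<open>c = 0\<close> cd show ?thesis by simp
qed

text \<open>
  Three instances of the Jacobi identity suffice: \<open>(X\<^sub>i, X\<^sub>i, Y\<^sub>j)\<close> determines the coefficient of \<open>H\<close> from
  that of \<open>L\<close>, \<open>(H\<^sub>i, X\<^sub>0, Y\<^sub>j)\<close> shows that the latter depends only on \<open>i + j\<close>, and \<open>(L\<^sub>m, X\<^sub>0, Y\<^sub>k)\<close> yields
  the recursion solved by \<open>structure_constants_rigid\<close>.
\<close>

lemma mixed_bracket_form:
  assumes f: "fX = - fY" "fY \<noteq> 0" and nz: "br (X i0) (Y j0) \<noteq> 0"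
  shows "\<exists>C. C \<noteq> 0 \<and> aX + aY = 0 \<and> bX + bY = 1 \<and> (\<forall>i j. br (X i) (Y j) =
    s C (L (i + j)) + s (C * (aX - of_int i + of_int (i + j) * bX) / fY) (H (i + j)))"
proof -
  have XX: "br (X i) (X j) = 0" for i j
    using XX_zero_if f by simp
  obtain c d where cd: "\<And>i j. br (X i) (Y j) = s (c i j) (L (i + j)) + s (d i j) (H (i + j))"
    using XY_span by metis
  have compare: "x = x' \<and> y = y'"
    if "s x (L k) + s y (H k) = s x' (L k) + s y' (H k)" for x x' y y' k
    using LH_independent[of "x - x'" k "y - y'"] that
    by (simp add: scale_left_diff_distrib algebra_simps)
  have d: "d i j = c i j * (aX - of_int i + of_int (i + j) * bX) / fY" for i j
  proof -
    have "br (X i) (br (X i) (Y j)) = - br (X i) (br (X i) (Y j))"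
      using jacobi_odd[OF X_odd X_odd, of i i "Y j"] by (simp add: XX br_simps)
    then have "s 2 (br (X i) (br (X i) (Y j))) = 0"
      by (metis add.right_inverse one_add_one scale_left_distrib scale_one)
    then have "br (X i) (br (X i) (Y j)) = 0"
      by simp
    then have "s (d i j * fY - c i j * (aX - of_int i + of_int (i + j) * bX)) (X (i + j + i)) = 0"
      unfolding cd by (simp add: br_simps XL XH f flip: scale_left_diff_distrib)
    then have "d i j * fY = c i j * (aX - of_int i + of_int (i + j) * bX)"
      using X_nonzero unfolding scale_eq_0_iff by (metis eq_iff_diff_eq_0)
    then show ?thesis
      using f by (metis nonzero_mult_div_cancel_right)
  qed
  define C where "C k = c 0 k" for k
  have c: "c i j = C (i + j)" for i j
  proof -
    have "br (H i) (br (X 0) (Y j)) = s (c 0 j * of_int i) (H (i + j))"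
      unfolding cd by (simp add: br_simps HL HH add.commute)
    moreover have "br (H i) (br (X 0) (Y j)) =
        s (fY * (c 0 (i + j) - c i j)) (L (i + j)) + s (fY * (d 0 (i + j) - d i j)) (H (i + j))"
      unfolding jacobi_even[OF H_even X_odd] HX HY
      by (simp add: br_simps cd f scale_right_distrib scale_left_diff_distrib right_diff_distrib)
    ultimately have "fY * (c 0 (i + j) - c i j) = 0"
      using compare[of "fY * (c 0 (i + j) - c i j)" "i + j" _ 0] by simp
    then show ?thesis using f by (simp add: C_def)
  qed
  have rec: "C k * of_int (m - k) = C (k + m) * (aX + aY - of_int k + of_int m * (bX + bY))" for k m
  proof -
    have "br (L m) (br (X 0) (Y k)) =
        s (c 0 k * of_int (m - k)) (L (m + k)) + s (- of_int k * d 0 k) (H (m + k))"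
      unfolding cd by (simp add: br_simps LL LH mult.commute)
    moreover define u v where "u = aX - of_int 0 + of_int m * bX" and "v = aY - of_int k + of_int m * bY"
    then have "br (L m) (br (X 0) (Y k)) =
        s (u * c m k + v * c 0 (m + k)) (L (m + k)) + s (u * d m k + v * d 0 (m + k)) (H (m + k))"
      unfolding jacobi_even[OF L_even X_odd] LX LY u_def[symmetric] v_def[symmetric]
      by (simp add: br_simps cd scale_right_distrib scale_left_distrib)
    ultimately have "c 0 k * of_int (m - k) = u * c m k + v * c 0 (m + k)"
      using compare by metis
    then show ?thesis
      by (simp add: c u_def v_def algebra_simps)
  qed
  have "C (i0 + j0) \<noteq> 0"
    using nz d[of i0 j0] unfolding cd by (auto simp: c)
  note rigid = structure_constants_rigid[OF rec this]
  have "br (X i) (Y j) = s (C 0) (L (i + j))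
      + s (C 0 * (aX - of_int i + of_int (i + j) * bX) / fY) (H (i + j))" for i j
    unfolding cd d c by (simp only: rigid(3)[of "i + j"])
  then show ?thesis
    using rigid(1,2,4) by blast
qed

end

section \<open>Coordinates on a super-extension\<close>

lemma independent_coeffs_zero:
  assumes s: "vector_space s" and inj: "inj_on e K" and fin: "finite K"
    and indep: "\<not> module.dependent s (e ` K)" and sum: "(\<Sum>p\<in>K. s (u p) (e p)) = 0" and "p \<in> K"
  shows "u p = 0"
proof -
  interpret vector_space s by (fact s)
  have "(\<Sum>v\<in>e ` K. s (u (inv_into K e v)) v) = 0"
    using sum by (simp add: sum.reindex[OF inj] inv_into_f_f[OF inj] cong: sum.cong)
  then have "u (inv_into K e (e p)) = 0"
    using \<open>p \<in> K\<close>
    by (intro independentD[OF indep finite_imageI[OF fin] order_refl,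
          where u = "\<lambda>v. u (inv_into K e v)"]) auto
  then show ?thesis by (simp add: inv_into_f_f[OF inj \<open>p \<in> K\<close>])
qed

text \<open>
  The value \<open>0\<close> at \<^const>\<open>IC\<close> makes \<open>\<complex>c\<^sub>H\<close> the kernel of the linear extension.
\<close>

definition ext_basis ::
    "(int \<Rightarrow> 'v) \<Rightarrow> (int \<Rightarrow> 'v) \<Rightarrow> (int \<Rightarrow> 'v) \<Rightarrow> (int \<Rightarrow> 'v) \<Rightarrow> hat_index \<Rightarrow> 'v::ab_group_add" where
  "ext_basis L H Gp Gm p = (case p of IL k \<Rightarrow> L k | IH k \<Rightarrow> H k | IGp k \<Rightarrow> Gp k | IGm k \<Rightarrow> Gm k | IC \<Rightarrow> 0)"

lemma index_families:
  "{p. index_parity p = 0} - {IC} = range (case_sum IL IH)"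
  "{p. index_parity p = 1} - {IC} = range (case_sum IGp IGm)"
proof -
  have "p \<in> range (case_sum IL IH)" if "index_parity p = 0" "p \<noteq> IC" for p
    using that by (cases p) (auto simp: image_iff split: sum.split intro: exI[of _ "Inl _"] exI[of _ "Inr _"])
  then show "{p. index_parity p = 0} - {IC} = range (case_sum IL IH)"
    by (auto split: sum.splits)
  have "p \<in> range (case_sum IGp IGm)" if "index_parity p = 1" for p
    using that by (cases p) (auto simp: image_iff split: sum.split intro: exI[of _ "Inl _"] exI[of _ "Inr _"])
  then show "{p. index_parity p = 1} - {IC} = range (case_sum IGp IGm)"
    by (auto split: sum.splits)
qed

lemma lin_ext_basis_family:
  assumes s: "vector_space s" and idx: "{p. index_parity p = i} - {IC} = range \<sigma>"
    and e: "\<And>k. e (\<sigma> k) = w k" "e IC = 0" and w: "basis_family s w W"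
  shows "lin_ext s e ` hat_grade i = W"
    and "\<And>x. x \<in> hat_grade i \<Longrightarrow> lin_ext s e x = 0 \<Longrightarrow> hat_center_rel x 0"
proof -
  interpret vector_space s by (fact s)
  note lin = linear_lin_ext[OF s, of e]
  interpret lin: Vector_Spaces.linear hat_scale s "lin_ext s e" by (fact lin)
  have w: "inj w" "independent (range w)" "span (range w) = W"
    using w unfolding basis_family_def by auto
  have "lin_ext s e x \<in> span (range w)" if "x \<in> hat_grade i" for x
    unfolding lin_ext_def
  proof (intro span_sum span_scale)
    fix p assume "p \<in> Poly_Mapping.keys x"
    then have "p = IC \<or> p \<in> range \<sigma>"
      using that idx by (auto simp: hat_grade_def)
    then show "e p \<in> span (range w)"
      using e by (auto intro: span_base span_zero)
  qed
  moreover have "span (range w) \<subseteq> lin_ext s e ` hat_grade i"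
  proof (rule span_minimal)
    show "range w \<subseteq> lin_ext s e ` hat_grade i"
    proof
      fix v assume "v \<in> range w"
      then obtain k where k: "v = w k" by blast
      have "\<sigma> k \<in> {p. index_parity p = i} - {IC}"
        unfolding idx by blast
      then have "mon (\<sigma> k) \<in> hat_grade i"
        by (simp add: hat_grade_def)
      then show "v \<in> lin_ext s e ` hat_grade i"
        using lin_ext_mon[OF s, of e "\<sigma> k"] k e(1)[of k] by (metis imageI)
    qed
    show "subspace (lin_ext s e ` hat_grade i)"
      by (rule lin.subspace_image[OF subspace_hat_grade])
  qed
  ultimately show "lin_ext s e ` hat_grade i = W"
    using w(3) by blast
  show "hat_center_rel x 0" if x: "x \<in> hat_grade i" and zero: "lin_ext s e x = 0" for x
  proof -
    let ?K = "Poly_Mapping.keys x - {IC}"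
    have K: "?K \<subseteq> range \<sigma>"
      using x unfolding idx[symmetric] by (auto simp: hat_grade_def)
    have "inj_on e (range \<sigma>)"
      using w(1) by (auto simp: inj_on_def e)
    then have "inj_on e ?K"
      using K inj_on_subset by blast
    moreover have "e ` range \<sigma> \<subseteq> range w"
      by (auto simp: e)
    then have "independent (e ` ?K)"
      using K w(2) independent_mono by (meson image_mono order_trans)
    moreover have "(\<Sum>p\<in>?K. s (Poly_Mapping.lookup x p) (e p)) = 0"
      using zero unfolding lin_ext_def
      by (subst sum.mono_neutral_left[of "Poly_Mapping.keys x"]) (auto simp: e)
    ultimately have "Poly_Mapping.lookup x p = 0" if "p \<in> ?K" for p
      using independent_coeffs_zero[OF s, of e ?K "Poly_Mapping.lookup x"] that by simp
    then show ?thesis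
      unfolding hat_center_rel_iff by (auto simp: in_keys_iff)
  qed
qed

lemma ext_basis_coordinates:
  assumes V: "lie_superalgebra s V br"
    and even: "basis_family s (case_sum L H) (V 0)" and odd: "basis_family s (case_sum Gp Gm) (V 1)"
  defines "\<Psi> \<equiv> lin_ext s (ext_basis L H Gp Gm)"
  shows "\<Psi> ` hat_grade i = V i" and "\<Psi> x = 0 \<longleftrightarrow> hat_center_rel x 0"
proof -
  interpret lie_superalgebra s V br by (fact V)
  note s = vector_space_axioms
  note L = linearD[OF linear_lin_ext[OF s, of "ext_basis L H Gp Gm"], folded \<Psi>_def]
  let ?e = "ext_basis L H Gp Gm"
  have e: "?e (case_sum IL IH k) = case_sum L H k" "?e (case_sum IGp IGm k) = case_sum Gp Gm k"
    "?e IC = 0" for k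
    by (auto simp: ext_basis_def split: sum.split)
  note even = lin_ext_basis_family[OF s index_families(1) e(1,3) even, folded \<Psi>_def]
  note odd = lin_ext_basis_family[OF s index_families(2) e(2,3) odd, folded \<Psi>_def]
  show grade: "\<Psi> ` hat_grade i = V i" for i
    using even(1) odd(1) by (cases i) auto
  show "\<Psi> x = 0 \<longleftrightarrow> hat_center_rel x 0"
  proof
    assume zero: "\<Psi> x = 0"
    obtain x0 x1 where x: "x0 \<in> hat_grade 0" "x1 \<in> hat_grade 1" "x = x0 + x1"
      using lie_superalgebra.grades_span[OF lie_superalgebra_hat] by blast
    have "\<Psi> x0 = - \<Psi> x1"
      using zero x(3) by (simp add: L eq_neg_iff_add_eq_0)
    then have "\<Psi> x0 \<in> V 0 \<inter> V 1"
      using x(1,2) grade subspace_neg[OF subspace_grade] by (metis IntI imageI)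
    then have "\<Psi> x0 = 0" "\<Psi> x1 = 0"
      using grades_disjoint \<open>\<Psi> x0 = - \<Psi> x1\<close> by auto
    then have "hat_center_rel x0 0" "hat_center_rel x1 0"
      using even(2) odd(2) x by auto
    then show "hat_center_rel x 0"
      unfolding hat_center_rel_iff x(3) by (simp add: lookup_add)
  next
    assume "hat_center_rel x 0"
    then obtain t where "x = hat_scale t (mon IC)"
      unfolding hat_center_rel_def by auto
    then show "\<Psi> x = 0"
      using L(2)[of t "mon IC"] lin_ext_mon[OF s, of ?e IC] e(3) by (simp add: \<Psi>_def)
  qed
qed

section \<open>Normalising the basis\<close>

text \<open>
  The change of basis is carried out inside the space with basis \<^typ>\<open>hat_index\<close>, where its inverse
  is again of the same form; the linear independence of the new basis of a super-extension then
  needs no separate argument.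
\<close>

definition renorm :: "complex \<Rightarrow> complex \<Rightarrow> complex \<Rightarrow> hat_index \<Rightarrow> hat" where
  "renorm \<alpha> \<eta> \<gamma> p = (case p of IL k \<Rightarrow> mon (IL k) + hat_monom (IH k) \<alpha>
     | IH k \<Rightarrow> hat_monom (IH k) \<eta> | IGp k \<Rightarrow> hat_monom (IGp k) \<gamma> | _ \<Rightarrow> mon p)"

abbreviation renorm_map :: "complex \<Rightarrow> complex \<Rightarrow> complex \<Rightarrow> hat \<Rightarrow> hat" where
  "renorm_map \<alpha> \<eta> \<gamma> \<equiv> lin_ext hat_scale (renorm \<alpha> \<eta> \<gamma>)"

lemma renorm_map_inverse:
  assumes "\<eta> \<noteq> 0" "\<gamma> \<noteq> 0"
  shows "renorm_map \<alpha> \<eta> \<gamma> (renorm_map (- \<alpha> / \<eta>) (1 / \<eta>) (1 / \<gamma>) x) = x"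
proof (rule linear_eq_on_keys[where f = "\<lambda>x. renorm_map \<alpha> \<eta> \<gamma> (renorm_map (- \<alpha> / \<eta>) (1 / \<eta>) (1 / \<gamma>) x)"
      and g = "\<lambda>x. x" and s = hat_scale])
  note lin = linear_lin_ext[OF vector_space_hat] and mon = lin_ext_mon[OF vector_space_hat]
  show "Vector_Spaces.linear hat_scale hat_scale
      (\<lambda>x. renorm_map \<alpha> \<eta> \<gamma> (renorm_map (- \<alpha> / \<eta>) (1 / \<eta>) (1 / \<gamma>) x))"
    using lin[of "renorm \<alpha> \<eta> \<gamma>"] lin[of "renorm (- \<alpha> / \<eta>) (1 / \<eta>) (1 / \<gamma>)"]
    by (simp add: linear_iff_laws)
  show "Vector_Spaces.linear hat_scale hat_scale (\<lambda>x. x)"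
    by (simp add: linear_iff_laws vector_space_hat)
  have monom: "renorm_map \<alpha> \<eta> \<gamma> (hat_monom p a) = hat_scale a (renorm \<alpha> \<eta> \<gamma> p)" for p a
    using linearD(2)[OF lin[of "renorm \<alpha> \<eta> \<gamma>"], of a "mon p"] mon by simp
  show "renorm_map \<alpha> \<eta> \<gamma> (renorm_map (- \<alpha> / \<eta>) (1 / \<eta>) (1 / \<gamma>) (mon p)) = mon p" for p
    using assms
    by (cases p) (simp_all add: mon renorm_def linearD(1)[OF lin] monom hat.scale_right_distrib
        flip: single_add)
qed

lemma renorm_map_graded: "x \<in> hat_grade i \<Longrightarrow> renorm_map \<alpha> \<eta> \<gamma> x \<in> hat_grade i"
  unfolding lin_ext_def
proof (intro hat.subspace_sum[OF subspace_hat_grade] hat.subspace_scale[OF subspace_hat_grade])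
  fix p assume "x \<in> hat_grade i" "p \<in> Poly_Mapping.keys x"
  then have "index_parity p = i" by (simp add: hat_grade_def)
  then show "renorm \<alpha> \<eta> \<gamma> p \<in> hat_grade i"
    by (cases p) (auto simp: renorm_def hat_grade_def in_keys_iff lookup_add lookup_single when_def
        split: if_splits)
qed

lemma renorm_map_center:
  assumes "hat_center_rel x 0"
  shows "hat_center_rel (renorm_map \<alpha> \<eta> \<gamma> x) 0"
proof -
  obtain t where "x = hat_scale t (mon IC)"
    using assms unfolding hat_center_rel_def by auto
  then have "renorm_map \<alpha> \<eta> \<gamma> x = hat_scale t (mon IC)"
    by (simp only: linearD(2)[OF linear_lin_ext[OF vector_space_hat]] lin_ext_mon[OF vector_space_hat])
      (simp add: renorm_def)
  then show ?thesis
    unfolding hat_center_rel_def by (metis diff_zero)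
qed

lemma renorm_map_image:
  assumes "\<eta> \<noteq> 0" "\<gamma> \<noteq> 0"
  shows "renorm_map \<alpha> \<eta> \<gamma> ` hat_grade i = hat_grade i"
  using renorm_map_inverse[OF assms] renorm_map_graded by (metis (no_types) image_eqI image_subsetI subsetI subset_antisym)

lemma renorm_map_center_iff:
  assumes "\<eta> \<noteq> 0" "\<gamma> \<noteq> 0"
  shows "hat_center_rel (renorm_map \<alpha> \<eta> \<gamma> x) 0 \<longleftrightarrow> hat_center_rel x 0"
proof
  have "renorm_map (- \<alpha> / \<eta>) (1 / \<eta>) (1 / \<gamma>) (renorm_map \<alpha> \<eta> \<gamma> x) = x"
    using renorm_map_inverse[of "1 / \<eta>" "1 / \<gamma>" "- \<alpha> / \<eta>" x] assms by simp
  then show "hat_center_rel (renorm_map \<alpha> \<eta> \<gamma> x) 0 \<Longrightarrow> hat_center_rel x 0"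
    by (metis renorm_map_center)
qed (rule renorm_map_center)

text \<open>
  The constant \<open>1/f\<close> turns the charges into \<open>\<plusminus>1\<close>, the factor \<open>1/C\<close> normalises the pairing, and adding
  \<open>(a/f) H\<^sub>k\<close> to \<open>L\<^sub>k\<close> shifts the scalar in \<open>[L\<^sub>m, G\<^sup>\<plusminus>\<^sub>i]\<close> by \<open>\<plusminus>a\<close>, which removes \<open>a\<close>.  The brackets of
  the even part are unchanged by these substitutions.
\<close>

lemma normal_form_homomorphism:
  fixes s :: "complex \<Rightarrow> 'v::ab_group_add \<Rightarrow> 'v"
  assumes V: "lie_superalgebra s V br"
    and parity: "\<And>k. L k \<in> V 0" "\<And>k. H k \<in> V 0" "\<And>k. Gp k \<in> V 1" "\<And>k. Gm k \<in> V 1"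
    and LL: "\<And>m n. br (L m) (L n) = s (of_int (m - n)) (L (m + n))"
    and HH: "\<And>m n. br (H m) (H n) = 0"
    and LH: "\<And>m n. br (L m) (H n) = s (- of_int n) (H (m + n))"
    and LGp: "\<And>m i. br (L m) (Gp i) = s (- a - of_int i + of_int m * (1 - b)) (Gp (m + i))"
    and LGm: "\<And>m i. br (L m) (Gm i) = s (a - of_int i + of_int m * b) (Gm (m + i))"
    and HGp: "\<And>n i. br (H n) (Gp i) = s f (Gp (n + i))"
    and HGm: "\<And>n i. br (H n) (Gm i) = s (- f) (Gm (n + i))"
    and GpGp: "\<And>i j. br (Gp i) (Gp j) = 0" and GmGm: "\<And>i j. br (Gm i) (Gm j) = 0"
    and GmGp: "\<And>i j. br (Gm i) (Gp j) =
      s C (L (i + j)) + s (C * (a - of_int i + of_int (i + j) * b) / f) (H (i + j))"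
    and nz: "f \<noteq> 0" "C \<noteq> 0"
  defines "\<Psi> \<equiv> \<lambda>x. lin_ext s (ext_basis L H Gp Gm) (renorm_map (a / f) (1 / f) (1 / C) x)"
  shows "\<Psi> (hat_bracket b x y) = br (\<Psi> x) (\<Psi> y)"
proof -
  interpret lie_superalgebra s V br by (fact V)
  note s = vector_space_axioms
  note br = linearD(1-5)[OF bracket_linear_left] linearD(1-5)[OF bracket_linear_right]
  let ?e = "ext_basis L H Gp Gm"
  have lin: "Vector_Spaces.linear hat_scale s \<Psi>"
    using linear_lin_ext[OF s, of ?e]
      linear_lin_ext[OF vector_space_hat, of "renorm (a / f) (1 / f) (1 / C)"]
    unfolding \<Psi>_def by (simp add: linear_iff_laws)
  note L0 = linearD[OF linear_lin_ext[OF s, of ?e]] lin_ext_mon[OF s, of ?e]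
  have e_monom: "lin_ext s ?e (hat_monom p t) = s t (?e p)" for p t
    using L0(2)[of t "mon p"] L0(7) by simp
  have \<Psi>_monom: "\<Psi> (hat_monom p t) = s t (\<Psi> (mon p))" for p t
    using linearD(2)[OF lin, of t "mon p"] by simp
  have basis: "\<Psi> (mon (IL k)) = L k + s (a / f) (H k)" "\<Psi> (mon (IH k)) = s (1 / f) (H k)"
    "\<Psi> (mon (IGp k)) = s (1 / C) (Gp k)" "\<Psi> (mon (IGm k)) = Gm k" "\<Psi> (mon IC) = 0" for k
    unfolding \<Psi>_def by (simp_all add: lin_ext_mon[OF vector_space_hat] renorm_def L0(1) e_monom)
      (simp_all add: ext_basis_def)
  have monom: "\<Psi> (hat_monom (IL k) t) = s t (L k) + s (t * a / f) (H k)"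
    "\<Psi> (hat_monom (IH k) t) = s (t / f) (H k)" "\<Psi> (hat_monom (IGp k) t) = s (t / C) (Gp k)"
    "\<Psi> (hat_monom (IGm k) t) = s t (Gm k)" "\<Psi> (hat_monom IC t) = 0" for k t
    unfolding \<Psi>_monom[of _ t] basis by (simp_all add: scale_right_distrib)
  have in_V: "\<Psi> (mon p) \<in> V (index_parity p)" for p
    by (cases p) (auto simp: basis parity
      intro!: subspace_add[OF subspace_grade] subspace_scale[OF subspace_grade] subspace_0[OF subspace_grade])
  let ?hom = "\<lambda>p q. \<Psi> (hat_table b p q) = br (\<Psi> (mon p)) (\<Psi> (mon q))"
  \<comment> \<open>Both brackets are super-skew, so one order of each pair of basis vectors suffices.\<close>
  have swap: "?hom q p" if "?hom p q" for p q
    unfolding bracket_skew[OF in_V in_V, of q p] hat_table_skew[of b q p] that[symmetric]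
    by (simp add: linearD[OF lin])
  have HL: "br (H n) (L m) = s (of_int n) (H (m + n))" for m n
    using bracket_skew[of "H n" 0 "L m" 0] by (simp add: LH parity)
  have eqI: "s x u + s y v = s x' u + s y' v" if "x = x'" "y = y'" for x y x' y' u v
    using that by simp
  have LL': "?hom (IL i) (IL j)" for i j
  proof -
    have "br (L i + s (a / f) (H i)) (L j + s (a / f) (H j))
       = s (of_int (i - j)) (L (i + j)) + s ((a / f) * (- of_int j) + (a / f) * of_int i) (H (i + j))"
      by (simp only: br LL LH HL HH scale_scale scale_zero_right scale_left_distrib)
        (simp add: add.commute)
    also have "\<dots> = s (of_int (i - j)) (L (i + j)) + s (of_int (i - j) * a / f) (H (i + j))"
      by (rule eqI) (use nz in \<open>simp_all add: field_simps\<close>)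
    finally show ?thesis
      by (simp add: linearD[OF lin] basis(1) monom)
  qed
  have LH': "?hom (IL i) (IH j)" for i j
    by (simp add: linearD[OF lin] basis monom br LH HH)
  have HH': "?hom (IH i) (IH j)" for i j
    by (simp add: linearD[OF lin] basis monom br HH)
  have LGp': "?hom (IL i) (IGp j)" for i j
  proof -
    define u where "u = - a - of_int j + of_int i * (1 - b)"
    have "br (L i) (Gp j) = s u (Gp (i + j))"
      by (simp only: LGp u_def)
    then have "br (L i + s (a / f) (H i)) (s (1 / C) (Gp j)) = s ((u + a) / C) (Gp (i + j))"
      using nz by (simp add: br HGp add_divide_distrib scale_left_distrib scale_right_distrib)
    also have "u + a = - of_int j + of_int i * (1 - b)"
      by (simp add: u_def)
    finally show ?thesis
      by (simp only: basis) (simp only: hat_table.simps monom)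
  qed
  have LGm': "?hom (IL i) (IGm j)" for i j
  proof -
    have "br (L i + s (a / f) (H i)) (Gm j) =
        s ((a - of_int j + of_int i * b) + (a / f) * - f) (Gm (i + j))"
      by (simp only: br LGm HGm scale_scale scale_left_distrib)
    also have "(a - of_int j + of_int i * b) + (a / f) * - f = - of_int j + of_int i * b"
      using nz by (simp add: field_simps)
    finally show ?thesis
      by (simp only: basis) (simp only: hat_table.simps monom)
  qed
  have HGp': "?hom (IH i) (IGp j)" for i j
    using nz by (simp add: basis monom br HGp)
  have HGm': "?hom (IH i) (IGm j)" for i j
    using nz by (simp add: basis monom br HGm linearD[OF lin])
  have GmGp': "?hom (IGm i) (IGp j)" for i j
  proof -
    let ?d = "- of_int i + of_int (i + j) * b"
    have "br (Gm i) (s (1 / C) (Gp j)) = s 1 (L (i + j)) + s (1 * a / f + ?d / f) (H (i + j))"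
      unfolding br GmGp scale_right_distrib scale_scale
      by (rule eqI) (use nz in \<open>simp_all add: field_simps\<close>)
    then show ?thesis
      by (simp add: linearD(1)[OF lin] basis monom scale_left_distrib add.assoc)
  qed
  have GG': "?hom (IGp i) (IGp j)" "?hom (IGm i) (IGm j)" for i j
    by (simp_all add: basis br GpGp GmGm linearD[OF lin])
  have C': "?hom IC p" for p
    by (simp add: basis br linearD[OF lin])
  have "?hom p q" for p q
    by (cases p; cases q)
      (auto intro: LL' LH' HH' LGp' LGm' HGp' HGm' GmGp' GG' C' swap[OF LH'] swap[OF LGp']
        swap[OF LGm'] swap[OF HGp'] swap[OF HGm'] swap[OF GmGp'] swap[OF C'] simp del: hat_table.simps)
  then have pq: "\<Psi> (hat_bracket b (mon p) (mon q)) = br (\<Psi> (mon p)) (\<Psi> (mon q))" for p q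
    by (simp only: hat_bracket_monom)
  have "\<Psi> (hat_bracket b (mon p) y) = br (\<Psi> (mon p)) (\<Psi> y)" for p
    by (rule linear_eq_on_keys[where s = s and x = y and f = "\<lambda>y. \<Psi> (hat_bracket b (mon p) y)"
          and g = "\<lambda>y. br (\<Psi> (mon p)) (\<Psi> y)"])
      (simp_all add: pq linear_iff_laws s vector_space_hat linearD[OF lin] br hat_bracket_simps)
  then show ?thesis
    by (intro linear_eq_on_keys[where s = s and x = x and f = "\<lambda>x. \<Psi> (hat_bracket b x y)"
          and g = "\<lambda>x. br (\<Psi> x) (\<Psi> y)"])
      (simp_all add: linear_iff_laws s vector_space_hat linearD[OF lin] br hat_bracket_simps)
qed

lemma nontrivial_super_extension_structure:
  fixes s :: "complex \<Rightarrow> 'v::ab_group_add \<Rightarrow> 'v"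
  assumes "nontrivial_super_extension s V br L H Gp Gm"
  obtains a b f C where "f \<noteq> 0" "C \<noteq> 0"
    "\<And>m i. br (L m) (Gp i) = s (- a - of_int i + of_int m * (1 - b)) (Gp (m + i))"
    "\<And>m i. br (L m) (Gm i) = s (a - of_int i + of_int m * b) (Gm (m + i))"
    "\<And>n i. br (H n) (Gp i) = s f (Gp (n + i))" "\<And>n i. br (H n) (Gm i) = s (- f) (Gm (n + i))"
    "\<And>i j. br (Gp i) (Gp j) = 0" "\<And>i j. br (Gm i) (Gm j) = 0"
    "\<And>i j. br (Gm i) (Gp j) =
      s C (L (i + j)) + s (C * (a - of_int i + of_int (i + j) * b) / f) (H (i + j))"
proof -
  have ext: "super_extension s V br L H Gp Gm" and nontriv: "\<exists>x \<in> V 1. \<exists>y \<in> V 1. br x y \<noteq> 0"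
    using assms unfolding nontrivial_super_extension_def by auto
  have V: "lie_superalgebra s V br"
    and even: "basis_family s (case_sum L H) (V 0)" and odd: "basis_family s (case_sum Gp Gm) (V 1)"
    and LL: "\<And>m n. br (L m) (L n) = s (of_int (m - n)) (L (m + n))"
    and HH: "\<And>m n. br (H m) (H n) = 0"
    and LH: "\<And>m n. br (L m) (H n) = s (- of_int n) (H (m + n))"
    and odd_span: "\<And>X Y i j. X \<in> {Gp, Gm} \<Longrightarrow> Y \<in> {Gp, Gm} \<Longrightarrow>
        br (X i) (Y j) \<in> module.span s {L (i + j), H (i + j)}"
    using ext unfolding super_extension_def by blast+
  obtain ap am bp bm f1 f2 where f12: "(f1, f2) \<noteq> (0, 0)"
    and action:
      "\<forall>m i. br (L m) (Gp i) = s (ap - of_int i + of_int m * bp) (Gp (m + i))"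
      "\<forall>m i. br (L m) (Gm i) = s (am - of_int i + of_int m * bm) (Gm (m + i))"
      "\<forall>n i. br (H n) (Gp i) = s f1 (Gp (n + i))"
      "\<forall>n i. br (H n) (Gm i) = s f2 (Gm (n + i))"
    using ext unfolding super_extension_def by (elim conjE exE) (rule that; assumption)
  note LGp = action(1)[rule_format] and LGm = action(2)[rule_format]
    and HGp = action(3)[rule_format] and HGm = action(4)[rule_format]
  interpret lie_superalgebra s V br by (fact V)
  note br = linearD(1-5)[OF bracket_linear_left] linearD(1-5)[OF bracket_linear_right]
  have parity: "L k \<in> V 0" "H k \<in> V 0" "Gp k \<in> V 1" "Gm k \<in> V 1" for k
    using even odd span_superset unfolding basis_family_def
    by (metis (no_types) rangeI subsetD sum.case)+
  have nonzero: "Gp k \<noteq> 0" "Gm k \<noteq> 0" for k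
    using odd dependent_zero unfolding basis_family_def by (metis (no_types) rangeI sum.case)+
  have indep: "c = 0 \<and> d = 0" if "s c (L k) + s d (H k) = 0" for c d k
  proof -
    have E: "inj (case_sum L H)" "independent (range (case_sum L H))"
      using even unfolding basis_family_def by auto
    have "independent (case_sum L H ` {Inl k, Inr k})"
      using E(2) by (rule independent_mono) blast
    moreover have "(\<Sum>p\<in>{Inl k, Inr k}. s (case_sum (\<lambda>_. c) (\<lambda>_. d) p) (case_sum L H p)) = 0"
      using that by simp
    ultimately have zero: "case_sum (\<lambda>_. c) (\<lambda>_. d) p = 0" if "p \<in> {Inl k, Inr k}" for p
      using independent_coeffs_zero[OF vector_space_axioms inj_on_subset[OF E(1) subset_UNIV] _ _ _ that]
      by blast
    show ?thesis
      using zero[of "Inl k"] zero[of "Inr k"] by simp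
  qed
  have coords: "\<exists>c d. br (X i) (Y j) = s c (L (i + j)) + s d (H (i + j))"
    if XY: "X \<in> {Gp, Gm}" "Y \<in> {Gp, Gm}" for X Y i j
  proof -
    obtain c where "br (X i) (Y j) - s c (L (i + j)) \<in> span {H (i + j)}"
      using odd_span[OF XY, of i j] unfolding span_insert by blast
    then obtain d where "br (X i) (Y j) - s c (L (i + j)) = s d (H (i + j))"
      unfolding span_singleton by blast
    then show ?thesis by (metis add.commute diff_eq_eq)
  qed
  interpret mp: odd_intermediate_series s V br L H Gm Gp am bm f2 ap bp f1
    by unfold_locales (rule parity nonzero LL HH LH LGp LGm HGp HGm | erule indep
        | (rule coords, simp, simp))+
  interpret pm: odd_intermediate_series s V br L H Gp Gm ap bp f1 am bm f2
    by unfold_locales (rule parity nonzero LL HH LH LGp LGm HGp HGm | erule indep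
        | (rule coords, simp, simp))+
  have swap: "br (Gp i) (Gm j) = br (Gm j) (Gp i)" for i j
    using bracket_skew[of "Gp i" 1 "Gm j" 1] parity by simp
  \<comment> \<open>If the mixed pairing vanished, so would all odd brackets: a charged family does not pair with
    itself, and an uncharged family has a charged partner.\<close>
  have "\<exists>i j. br (Gm i) (Gp j) \<noteq> 0"
  proof (rule ccontr)
    assume "\<nexists>i j. br (Gm i) (Gp j) \<noteq> 0"
    then have mixed: "br (Gm i) (Gp j) = 0" "br (Gp i) (Gm j) = 0" for i j
      by (auto simp: swap)
    have pp: "br (Gp i) (Gp j) = 0" for i j
      using pm.XX_zero_if pm.XX_zero_if_Y_charged[OF _ mixed(2)] f12 by (cases "f1 = 0") auto
    have mm: "br (Gm i) (Gm j) = 0" for i j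
      using mp.XX_zero_if mp.XX_zero_if_Y_charged[OF _ mixed(1)] f12 by (cases "f2 = 0") auto
    let ?G = "range (case_sum Gp Gm)"
    have G: "v \<in> span ?G" if "v \<in> V 1" for v
      using odd that unfolding basis_family_def by simp
    have GG: "br x y = 0" if "x \<in> ?G" "y \<in> ?G" for x y
      using that by (auto simp: mixed pp mm split: sum.splits)
    have GV: "br x y = 0" if "x \<in> ?G" "y \<in> V 1" for x y
      using G[OF that(2)] by (induction rule: span_induct_alt) (simp_all add: br GG that(1))
    have "br x y = 0" if "x \<in> V 1" "y \<in> V 1" for x y
      using G[OF that(1)] by (induction rule: span_induct_alt) (simp_all add: br GV that(2))
    then show False using nontriv by blast
  qed
  then obtain i0 j0 where nz: "br (Gm i0) (Gp j0) \<noteq> 0" by blast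
  then have f2: "f2 = - f1"
    using mp.XY_zero_if[of i0 j0] by (metis add_eq_0_iff2)
  then have f1: "f1 \<noteq> 0" using f12 by auto
  obtain C where C: "C \<noteq> 0" "am + ap = 0" "bm + bp = 1" and GmGp: "\<And>i j. br (Gm i) (Gp j) =
      s C (L (i + j)) + s (C * (am - of_int i + of_int (i + j) * bm) / f1) (H (i + j))"
    using mp.mixed_bracket_form[OF f2 f1 nz] by blast
  have "ap = - am" "bp = 1 - bm"
    using C(2,3) by (simp_all add: eq_neg_iff_add_eq_0 add.commute eq_diff_eq)
  with f1 C(1) LGp LGm HGp HGm f2 pm.XX_zero_if mp.XX_zero_if GmGp show thesis
    by (intro that[of f1 C am bm]) auto
qed

theorem theorem2p1:
  shows "(\<forall>b. lie_superalgebra hat_scale hat_grade (hat_bracket b)) \<and>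
    (\<forall>(scale :: complex \<Rightarrow> 'v::ab_group_add \<Rightarrow> 'v) V br L H Gp Gm.
       nontrivial_super_extension scale V br L H Gp Gm \<longrightarrow>
       (\<exists>b \<Phi>. lie_superalgebra_iso scale V br quot_scale quot_grade (quot_bracket b) \<Phi> \<and>
          (\<forall>\<phi>. two_cocycle scale V br \<phi> \<longrightarrow>
             (\<exists>\<kappa> \<psi>. is_psi_form b \<kappa> \<psi> \<and>
                coboundary scale br (\<lambda>x y. \<phi> x y - \<psi> (\<Phi> x) (\<Phi> y))))))"
proof (intro conjI allI impI lie_superalgebra_hat)
  fix s :: "complex \<Rightarrow> 'v \<Rightarrow> 'v" and V br L H Gp Gm
  assume N: "nontrivial_super_extension s V br L H Gp Gm"
  then have V: "lie_superalgebra s V br"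
    and even: "basis_family s (case_sum L H) (V 0)" and odd: "basis_family s (case_sum Gp Gm) (V 1)"
    and LL: "\<And>m n. br (L m) (L n) = s (of_int (m - n)) (L (m + n))"
    and HH: "\<And>m n. br (H m) (H n) = 0"
    and LH: "\<And>m n. br (L m) (H n) = s (- of_int n) (H (m + n))"
    unfolding nontrivial_super_extension_def super_extension_def by blast+
  interpret lie_superalgebra s V br by (fact V)
  have parity: "L k \<in> V 0" "H k \<in> V 0" "Gp k \<in> V 1" "Gm k \<in> V 1" for k
    using even odd span_superset unfolding basis_family_def
    by (metis (no_types) rangeI subsetD sum.case)+
  obtain a b f C where nz: "f \<noteq> 0" "C \<noteq> 0"
    and rel: "\<And>m i. br (L m) (Gp i) = s (- a - of_int i + of_int m * (1 - b)) (Gp (m + i))"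
    "\<And>m i. br (L m) (Gm i) = s (a - of_int i + of_int m * b) (Gm (m + i))"
    "\<And>n i. br (H n) (Gp i) = s f (Gp (n + i))" "\<And>n i. br (H n) (Gm i) = s (- f) (Gm (n + i))"
    "\<And>i j. br (Gp i) (Gp j) = 0" "\<And>i j. br (Gm i) (Gm j) = 0"
    "\<And>i j. br (Gm i) (Gp j) =
      s C (L (i + j)) + s (C * (a - of_int i + of_int (i + j) * b) / f) (H (i + j))"
    by (rule nontrivial_super_extension_structure[OF N]) blast
  have nz': "1 / f \<noteq> 0" "1 / C \<noteq> 0"
    using nz by auto
  let ?T = "renorm_map (a / f) (1 / f) (1 / C)"
  let ?\<Psi> = "\<lambda>x. lin_ext s (ext_basis L H Gp Gm) (?T x)"
  note coords = ext_basis_coordinates[OF V even odd]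
  have lin: "Vector_Spaces.linear hat_scale s ?\<Psi>"
    using linear_lin_ext[OF vector_space_axioms, of "ext_basis L H Gp Gm"]
      linear_lin_ext[OF vector_space_hat, of "renorm (a / f) (1 / f) (1 / C)"]
    by (simp add: linear_iff_laws)
  have hom: "?\<Psi> (hat_bracket b x y) = br (?\<Psi> x) (?\<Psi> y)" for x y
    by (rule normal_form_homomorphism[OF V parity LL HH LH rel nz])
  have grade: "?\<Psi> ` hat_grade i = V i" for i
    using coords(1)[of i] renorm_map_image[OF nz', of "a / f" i] by (metis image_image)
  have ker: "?\<Psi> x = 0 \<longleftrightarrow> hat_center_rel x 0" for x
    using coords(2) renorm_map_center_iff[OF nz'] by simp
  show "\<exists>b \<Phi>. lie_superalgebra_iso s V br quot_scale quot_grade (quot_bracket b) \<Phi> \<and>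
      (\<forall>\<phi>. two_cocycle s V br \<phi> \<longrightarrow>
        (\<exists>\<kappa> \<psi>. is_psi_form b \<kappa> \<psi> \<and> coboundary s br (\<lambda>x y. \<phi> x y - \<psi> (\<Phi> x) (\<Phi> y))))"
    by (intro exI[of _ b] iso_and_cocycles_of_center_quotient[OF V lin hom grade ker])
qed

end
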